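(* Let $n\ge2$, $\mathfrak g=\mathfrak{sl}_n$, and let $\lambda\in\mathbb C$, $\lambda\neq0$. For $k=1,\dots,n$, define $I_k\in\mathcal S(R_-^n)_\lambda^*$ by $$I_k(f)=\int_{\mathbb R^k}f(x_{-1}^1,\dots,x_{-1}^k,0,0,\dots)\,dx_{-1}^1\cdots dx_{-1}^k .$$ Then $I_k$ is a highest weight vector for the dual representation $\pi^*$ of $\hat{\mathfrak g}$ on $\mathcal S(R_-^n)_\lambda^*$, with highest weight $\Lambda_k$ given by $$\langle\Lambda_k,E_{ii}-E_{i+1,i+1}\rangle=0\quad\text{for } 1\le i\le n-1,\ i\ne k,$$ $$\langle\Lambda_k,E_{kk}-E_{k+1,k+1}\rangle=-1\quad\text{for }1\le k\le n-1,$$ $$\langle\Lambda_k,K\rangle=-1.$$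
   Context: $R_-^n=\mathbb R^n[t^{-1}]t^{-1}$; an element is written $x=\sum_{i\ge1}\sum_{j=1}^n x_{-i}^je_jt^{-i}$ (finitely many non-zero coordinates), equivalently as $(x_{-1},x_{-2},\dots)$ with $x_{-i}\in\mathbb R^n$; functions are written as functions of $(x_{-1}^1,\dots,x_{-1}^n,x_{-2}^1,\dots)$. $\mathcal S(R_-^n)$ is the space of complex-valued functions on $R_-^n$ whose restriction to every finite-dimensional subspace is a Schwartz function. The operator $\pi_t$ is $\pi_tf(x_{-1},x_{-2},\dots)=\int_{\mathbb R^n}f(y,x_{-1},x_{-2},\dots)\,dy$, and $\mathcal S(R_-^n)_\lambda=\{f\in\mathcal S(R_-^n):\pi_tf=\lambda f\}$. The affine algebra is $\hat{\mathfrak g}=\mathfrak{sl}_n\otimes\mathbb C[t,t^{-1}]\oplus\mathbb CK$ with $K$ central and $[at^m,bt^k]=[a,b]t^{m+k}+m\,\delta_{m+k,0}\,\mathrm{tr}(ab)\,K$. Its representation $\pi$ on $\mathcal S(R_-^n)_\lambda$ is given by $K\mapsto1$; for $j\ge0$ and $a\in\mathfrak{sl}_n$, $\pi(at^j)$ is obtained by linearity from $\pi(E_{uv}t^j)=-\sum_{i\ge1}x^v_{-i-j}\partial_{x^u_{-i}}$; and for $j>0$, $u\neq v$, $$\pi(E_{uv}t^{-j})=-\lambda^{-j}\pi_t^j\sum_{i\ge1}x_{-i}^v\partial_{x_{-i-j}^u},\quad \pi((E_{uu}-E_{vv})t^{-j})=-\lambda^{-j}\pi_t^j\sum_{i\ge1}\left(x_{-i}^u\partial_{x_{-i-j}^u}-x_{-i}^v\partial_{x_{-i-j}^v}\right),$$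 where $E_{uv}$ is the matrix unit. $\mathcal S(R_-^n)_\lambda^*$ is the full (algebraic) dual space, with the action $\langle\pi^*(a)\varphi,f\rangle=-\langle\varphi,\pi(a)f\rangle$. The triangular decomposition is $\hat{\mathfrak g}=\hat n^-\oplus\hat{\mathfrak h}\oplus\hat n^+$ with $\hat{\mathfrak h}=\mathfrak h+\mathbb CK$, $\hat n^{-}=n^-\oplus\mathfrak g[t^{-1}]t^{-1}$, $\hat n^+=n^+\oplus\mathfrak g[t]t$, where $\mathfrak h$, $n^+$, $n^-$ are the diagonal, strictly upper triangular and strictly lower triangular matrices in $\mathfrak{sl}_n$. A highest weight vector of weight $\Lambda\in\hat{\mathfrak h}^*$ is a non-zero vector killed by $\hat n^+$ on which each $h\in\hat{\mathfrak h}$ acts by the scalar $\langle\Lambda,h\rangle$. *)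

theory Defs
  imports "HOL-Analysis.Analysis" "HOL-Analysis.Finite_Function_Topology"
begin

text \<open>The index set \<open>{1,\<dots>,n}\<close> is a finite linearly ordered type \<open>'n\<close>, so that \<open>\<real>\<^sup>n\<close> is
  \<^typ>\<open>real ^ 'n\<close>. An element \<open>x\<close> of \<open>R\<^sub>-\<^sup>n\<close> is a finitely supported sequence of vectors,
  numbered from 0: \<open>lookup x i\<close> is \<open>x\<^bsub>-(i+1)\<^esub>\<close>.\<close>

type_synonym 'n rminus = "nat \<Rightarrow>\<^sub>0 (real ^ 'n)"

text \<open>The \<open>i\<close>-th and the next index, \<open>i + 1\<close>.\<close>

definition next_index :: "'n::linorder \<Rightarrow> 'n \<Rightarrow> bool" where
  "next_index i i' \<longleftrightarrow> i < i' \<and> (\<forall>j. \<not> (i < j \<and> j < i'))"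


section \<open>Schwartz functions\<close>

definition dir_deriv :: "'a::real_vector \<Rightarrow> ('a \<Rightarrow> complex) \<Rightarrow> 'a \<Rightarrow> complex" where
  "dir_deriv v f x = vector_derivative (\<lambda>s::real. f (x + s *\<^sub>R v)) (at 0)"

definition iter_deriv :: "'a::real_vector list \<Rightarrow> ('a \<Rightarrow> complex) \<Rightarrow> 'a \<Rightarrow> complex" where
  "iter_deriv vs f = foldr dir_deriv vs f"

text \<open>Intended for a finite-dimensional subspace \<open>V\<close>: the restriction of \<open>f\<close> to \<open>V\<close> is smooth (its
  iterated directional derivatives along \<open>V\<close> all exist and are continuous on \<open>V\<close>) and every
  derivative decreases rapidly. As norms on \<open>V\<close> are equivalent, the choice of norm is irrelevant.
  Only the values of \<open>f\<close> on \<open>V\<close> enter.\<close>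

definition schwartz_on :: "'a::real_normed_vector set \<Rightarrow> ('a \<Rightarrow> complex) \<Rightarrow> bool" where
  "schwartz_on V f \<longleftrightarrow> (\<forall>vs. set vs \<subseteq> V \<longrightarrow>
     (\<forall>x\<in>V. \<forall>v\<in>V. (\<lambda>s::real. iter_deriv vs f (x + s *\<^sub>R v)) differentiable at 0) \<and>
     continuous_on V (iter_deriv vs f) \<and>
     (\<forall>m::nat. \<exists>C. \<forall>x\<in>V. norm x ^ m * norm (iter_deriv vs f x) \<le> C))"

text \<open>The finite-dimensional subspaces are the spans of the finite sets.\<close>

definition schwartz_space :: "('n::finite rminus \<Rightarrow> complex) set" where
  "schwartz_space = {f. \<forall>B. finite B \<longrightarrow> schwartz_on (span B) f}"


section \<open>The operator \<open>\<pi>\<^sub>t\<close> and its eigenspaces\<close>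

text \<open>\<open>prepend y (x\<^sub>-\<^sub>1, x\<^sub>-\<^sub>2, \<dots>) = (y, x\<^sub>-\<^sub>1, x\<^sub>-\<^sub>2, \<dots>)\<close>\<close>

lift_definition prepend :: "'b::zero \<Rightarrow> (nat \<Rightarrow>\<^sub>0 'b) \<Rightarrow> (nat \<Rightarrow>\<^sub>0 'b)" is
  "\<lambda>y x i. case i of 0 \<Rightarrow> y | Suc j \<Rightarrow> x j"
proof -
  fix y :: 'b and x :: "nat \<Rightarrow> 'b"
  assume "finite {i. x i \<noteq> 0}"
  then have "finite (insert 0 (Suc ` {i. x i \<noteq> 0}))" by simp
  moreover have "{i. (case i of 0 \<Rightarrow> y | Suc j \<Rightarrow> x j) \<noteq> 0} \<subseteq> insert 0 (Suc ` {i. x i \<noteq> 0})"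
  proof
    fix i assume "i \<in> {i. (case i of 0 \<Rightarrow> y | Suc j \<Rightarrow> x j) \<noteq> 0}"
    then show "i \<in> insert 0 (Suc ` {i. x i \<noteq> 0})" by (cases i) auto
  qed
  ultimately show "finite {i. (case i of 0 \<Rightarrow> y | Suc j \<Rightarrow> x j) \<noteq> 0}"
    by (rule rev_finite_subset)
qed

definition pi_t :: "('n::finite rminus \<Rightarrow> complex) \<Rightarrow> 'n rminus \<Rightarrow> complex" where
  "pi_t f x = (LINT y|lborel. f (prepend y x))"

definition schwartz_eigen :: "complex \<Rightarrow> ('n::finite rminus \<Rightarrow> complex) set" where
  "schwartz_eigen lam = {f \<in> schwartz_space. pi_t f = (\<lambda>x. lam * f x)}"


section \<open>The affine algebra and its representation\<close>

text \<open>\<open>(a, c)\<close> stands for \<open>(\<Sum>m. a\<^sub>m t\<^sup>m) + c K\<close>. The bracket is not needed to say what a highest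
  weight vector is, so only the vector space structure appears.\<close>

type_synonym 'n affine = "(int \<Rightarrow>\<^sub>0 (complex ^ 'n ^ 'n)) \<times> complex"

definition affine_scale :: "complex \<Rightarrow> 'n::finite affine \<Rightarrow> 'n affine" where
  "affine_scale c X = (Poly_Mapping.map (map_matrix ((*) c)) (fst X), c * snd X)"

definition affine_sl :: "'n::finite affine set" where
  "affine_sl = {X. \<forall>m. trace (Poly_Mapping.lookup (fst X) m) = 0}"

definition cartan_hat :: "'n::finite affine set" where
  "cartan_hat = {X \<in> affine_sl. (\<forall>m. m \<noteq> 0 \<longrightarrow> Poly_Mapping.lookup (fst X) m = 0) \<and>
     (\<forall>u v. u \<noteq> v \<longrightarrow> Poly_Mapping.lookup (fst X) 0 $ u $ v = 0)}"

definition nplus_hat :: "'n::{finite,linorder} affine set" where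
  "nplus_hat = {X \<in> affine_sl. snd X = 0 \<and> (\<forall>m<0. Poly_Mapping.lookup (fst X) m = 0) \<and>
     (\<forall>u v. v \<le> u \<longrightarrow> Poly_Mapping.lookup (fst X) 0 $ u $ v = 0)}"

definition mat_unit :: "'n::finite \<Rightarrow> 'n \<Rightarrow> complex ^ 'n ^ 'n" where
  "mat_unit u v = (\<chi> i j. if i = u \<and> j = v then 1 else 0)"

definition loop :: "complex ^ 'n ^ 'n \<Rightarrow> int \<Rightarrow> 'n::finite affine" where
  "loop a m = (Poly_Mapping.single m a, 0)"

definition central :: "'n::finite affine" where
  "central = (0, 1)"

text \<open>\<open>\<partial>/\<partial>x\<^sup>u\<^bsub>-(i+1)\<^esub>\<close>\<close>

definition partial_x :: "nat \<Rightarrow> 'n::finite \<Rightarrow> ('n rminus \<Rightarrow> complex) \<Rightarrow> 'n rminus \<Rightarrow> complex" where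
  "partial_x i u = dir_deriv (Poly_Mapping.single i (axis u 1))"

text \<open>\<open>\<Sum>\<^bsub>i\<ge>1\<^esub> x\<^sup>v\<^bsub>-i-p\<^esub> \<partial>/\<partial>x\<^sup>u\<^bsub>-i-q\<^esub>\<close>; at every point only finitely many terms are non-zero.\<close>

definition vector_field ::
    "nat \<Rightarrow> nat \<Rightarrow> 'n::finite \<Rightarrow> 'n \<Rightarrow> ('n rminus \<Rightarrow> complex) \<Rightarrow> 'n rminus \<Rightarrow> complex" where
  "vector_field p q u v f x =
     suminf (\<lambda>i. complex_of_real (Poly_Mapping.lookup x (i + p) $ v) * partial_x (i + q) u f x)"

text \<open>The operator \<open>\<pi>(a t\<^sup>m)\<close>, extended linearly in \<open>a = \<Sum>u v. a\<^sub>u\<^sub>v E\<^sub>u\<^sub>v\<close> from the generators (see the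
  lemmas below).\<close>

definition pi_mode ::
    "complex \<Rightarrow> complex ^ 'n ^ 'n \<Rightarrow> int \<Rightarrow> ('n::finite rminus \<Rightarrow> complex) \<Rightarrow> 'n rminus \<Rightarrow> complex" where
  "pi_mode lam a m f =
     (if m \<ge> 0
      then (\<lambda>x. - (\<Sum>u\<in>UNIV. \<Sum>v\<in>UNIV. a $ u $ v * vector_field (nat m) 0 u v f x))
      else (\<lambda>x. - (lam powi m) *
             (pi_t ^^ nat (- m)) 
               (\<lambda>x. \<Sum>u\<in>UNIV. \<Sum>v\<in>UNIV. a $ u $ v * vector_field 0 (nat (- m)) u v f x) x))"

definition pi_rep ::
    "complex \<Rightarrow> 'n::finite affine \<Rightarrow> ('n rminus \<Rightarrow> complex) \<Rightarrow> 'n rminus \<Rightarrow> complex" where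
  "pi_rep lam X f x =
     (\<Sum>m\<in>Poly_Mapping.keys (fst X). pi_mode lam (Poly_Mapping.lookup (fst X) m) m f x) + snd X * f x"

lemma sum_mat_unit:
  fixes g :: "'n::finite \<Rightarrow> 'n \<Rightarrow> complex"
  shows "(\<Sum>i\<in>UNIV. \<Sum>j\<in>UNIV. mat_unit u v $ i $ j * g i j) = g u v"
proof -
  have "(\<Sum>j\<in>UNIV. mat_unit u v $ i $ j * g i j) = (if i = u then g u v else 0)" for i
    by (cases "i = u") (simp_all add: mat_unit_def if_distrib[of "\<lambda>c. c * _"] cong: if_cong)
  then show ?thesis by simp
qed

lemma pi_rep_single: "pi_rep lam (loop a m) f x = pi_mode lam a m f x"
proof (cases "a = 0")
  case True
  have z: "pi_t (\<lambda>x. 0) = (\<lambda>x::'a rminus. 0)" by (simp add: pi_t_def fun_eq_iff)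
  have "(pi_t ^^ j) (\<lambda>x. 0) = (\<lambda>x::'a rminus. 0)" for j
    by (induction j) (simp_all add: z)
  then show ?thesis using True by (simp add: pi_rep_def pi_mode_def loop_def)
qed (simp add: pi_rep_def loop_def)

lemma vector_field_sums:
  "(\<lambda>i. complex_of_real (Poly_Mapping.lookup x (i + p) $ v) * partial_x (i + q) u f x)
     sums vector_field p q u v f x"
proof -
  let ?g = "\<lambda>i. complex_of_real (Poly_Mapping.lookup x (i + p) $ v) * partial_x (i + q) u f x"
  have "finite ((\<lambda>i. i + p) -` Poly_Mapping.keys x)"
    by (rule finite_vimageI) (simp_all add: inj_on_def)
  moreover have "{i. ?g i \<noteq> 0} \<subseteq> (\<lambda>i. i + p) -` Poly_Mapping.keys x"
    by (auto simp: in_keys_iff)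
  ultimately have "finite {i. ?g i \<noteq> 0}" by (rule rev_finite_subset)
  then have "summable ?g" by (rule summable_finite) auto
  then show ?thesis unfolding vector_field_def by (rule summable_sums)
qed

lemma pi_rep_nonneg:
  "pi_rep lam (loop (mat_unit u v) (int j)) f x =
     - (suminf (\<lambda>i. complex_of_real (Poly_Mapping.lookup x (i + j) $ v) * partial_x i u f x))"
  by (simp add: pi_rep_single pi_mode_def sum_mat_unit vector_field_def)

lemma pi_rep_neg_offdiag:
  assumes "j > 0"
  shows "pi_rep lam (loop (mat_unit u v) (- int j)) f x =
     - (lam powi (- int j)) * (pi_t ^^ j)
         (\<lambda>x. suminf (\<lambda>i. complex_of_real (Poly_Mapping.lookup x i $ v) * partial_x (i + j) u f x)) x"
  using assms by (simp add: pi_rep_single pi_mode_def sum_mat_unit vector_field_def)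

lemma pi_rep_neg_diag:
  assumes "j > 0"
  shows "pi_rep lam (loop (mat_unit u u - mat_unit v v) (- int j)) f x =
     - (lam powi (- int j)) * (pi_t ^^ j)
         (\<lambda>x. suminf (\<lambda>i. complex_of_real (Poly_Mapping.lookup x i $ u) * partial_x (i + j) u f x
                  - complex_of_real (Poly_Mapping.lookup x i $ v) * partial_x (i + j) v f x)) x"
proof -
  have "(suminf (\<lambda>i. complex_of_real (Poly_Mapping.lookup x i $ u) * partial_x (i + j) u f x
             - complex_of_real (Poly_Mapping.lookup x i $ v) * partial_x (i + j) v f x))
        = vector_field 0 j u u f x - vector_field 0 j v v f x" for x
    using sums_diff[OF vector_field_sums[of x 0 u j u f] vector_field_sums[of x 0 v j v f]]
    by (simp add: sums_iff)
  then show ?thesis using assms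
    by (simp add: pi_rep_single pi_mode_def left_diff_distrib sum_subtractf sum_mat_unit)
qed


section \<open>The dual representation and highest weight vectors\<close>

text \<open>The algebraic dual of \<open>S(R\<^sub>-\<^sup>n)\<^sub>\<lambda>\<close>; its elements have no values outside that space.\<close>

definition schwartz_dual :: "complex \<Rightarrow> (('n::finite rminus \<Rightarrow> complex) \<Rightarrow> complex) set" where
  "schwartz_dual lam = {\<phi> \<in> extensional (schwartz_eigen lam).
     (\<forall>f\<in>schwartz_eigen lam. \<forall>g\<in>schwartz_eigen lam. \<phi> (\<lambda>x. f x + g x) = \<phi> f + \<phi> g) \<and>
     (\<forall>f\<in>schwartz_eigen lam. \<forall>c. \<phi> (\<lambda>x. c * f x) = c * \<phi> f)}"

definition pi_star ::
    "complex \<Rightarrow> 'n::finite affine \<Rightarrow> (('n rminus \<Rightarrow> complex) \<Rightarrow> complex)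
       \<Rightarrow> ('n rminus \<Rightarrow> complex) \<Rightarrow> complex" where
  "pi_star lam X \<phi> = (\<lambda>f\<in>schwartz_eigen lam. - \<phi> (pi_rep lam X f))"

definition cartan_dual :: "('n::finite affine \<Rightarrow> complex) set" where
  "cartan_dual = {\<Lambda>. (\<forall>X\<in>cartan_hat. \<forall>Y\<in>cartan_hat. \<Lambda> (X + Y) = \<Lambda> X + \<Lambda> Y) \<and>
     (\<forall>X\<in>cartan_hat. \<forall>c. \<Lambda> (affine_scale c X) = c * \<Lambda> X)}"

definition highest_weight_vector ::
    "complex \<Rightarrow> ('n::{finite,linorder} affine \<Rightarrow> complex)
       \<Rightarrow> (('n rminus \<Rightarrow> complex) \<Rightarrow> complex) \<Rightarrow> bool" where
  "highest_weight_vector lam \<Lambda> \<phi> \<longleftrightarrow>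
     \<phi> \<in> schwartz_dual lam \<and> \<phi> \<noteq> (\<lambda>f\<in>schwartz_eigen lam. 0) \<and>
     (\<forall>X\<in>nplus_hat. pi_star lam X \<phi> = (\<lambda>f\<in>schwartz_eigen lam. 0)) \<and>
     (\<forall>X\<in>cartan_hat. pi_star lam X \<phi> = (\<lambda>f\<in>schwartz_eigen lam. \<Lambda> X * \<phi> f))"

text \<open>\<open>I\<^sub>k\<close>: the coordinates \<open>x\<^sup>j\<^sub>-\<^sub>1\<close> with \<open>j \<le> k\<close> are integrated over \<open>\<real>\<^sup>k\<close>, all others are 0.\<close>

definition I_functional ::
    "complex \<Rightarrow> 'n::{finite,linorder} \<Rightarrow> ('n rminus \<Rightarrow> complex) \<Rightarrow> complex" where
  "I_functional lam k = (\<lambda>f\<in>schwartz_eigen lam.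
     LINT y|(\<Pi>\<^sub>M j\<in>{..k}. lborel).
       f (Poly_Mapping.single 0 (\<chi> j. if j \<le> k then y j else 0)))"

end

theory Submission
  imports Defs "HOL-Probability.Sinc_Integral"
begin

text \<open>Let \<open>(T\<^sub>J f)(z)\<close> be the integral of \<open>f\<close> over the affine subspace through \<open>z\<close> in the
  directions of those coordinates of the first vector \<open>x\<^sub>-\<^sub>1\<close> whose index lies in \<open>J\<close>
  (\<open>fiber_integral\<close>). Both kinds of integral in the statement are instances:
  \<open>(\<pi>\<^sub>t f)(x) = (T\<^sub>J f)(0, x)\<close> with \<open>J\<close> the set of all indices, and \<open>I\<^sub>k f = (T\<^sub>J f)(0)\<close> with
  \<open>J = {1, \<dots>, k}\<close>. Two facts about \<open>T\<^sub>J\<close> carry the argument. It commutes with every directional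
  derivative (\<open>fiber_integral_dir_deriv\<close>), and it is invariant under translations along the fibre;
  together these give \<open>T\<^sub>J \<partial>\<^sub>u f = 0\<close> for the directions \<open>u \<in> J\<close>. Applied to \<open>x\<^sup>v\<^sub>-\<^sub>1 f\<close> this becomes
  integration by parts, \<open>T\<^sub>J (x\<^sup>v\<^sub>-\<^sub>1 \<partial>\<^sub>u f) = - \<delta>\<^sub>u\<^sub>v T\<^sub>J f\<close> (\<open>fiber_integral_by_parts\<close>).

  With \<open>J\<close> the set of all indices, integration by parts shows that \<open>\<pi>\<^sub>t\<close> commutes with the vector
  field of \<open>E\<^sub>u\<^sub>v t\<^sup>j\<close>, \<open>j \<ge> 0\<close>, except for a defect \<open>-\<delta>\<^sub>u\<^sub>v \<pi>\<^sub>t\<close> when \<open>j = 0\<close>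
  (\<open>pi_t_vector_field\<close>). The defects add up to a multiple of the trace, so the nonnegative modes of
  \<open>sl\<^sub>n\<close> preserve the eigenspace. This has to be known before \<open>\<pi>\<^sup>*\<close> can be computed, because \<open>I\<^sub>k\<close>
  is a functional on the eigenspace only.

  With \<open>J = {1, \<dots>, k}\<close> and \<open>z = 0\<close>, the vector field of \<open>E\<^sub>u\<^sub>v t\<^sup>j\<close> vanishes on the fibre if
  \<open>j > 0\<close>, and also if \<open>j = 0\<close> and \<open>v > k\<close>. If \<open>j = 0\<close> and \<open>u \<le> v \<le> k\<close>, integration by parts
  applies. Hence an upper triangular \<open>a\<close> satisfies \<open>I\<^sub>k (\<pi>(a) f) = (\<Sum>u\<le>k. a\<^sub>u\<^sub>u) I\<^sub>k f\<close>, and after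
  dualising the weight is \<open>a + c K \<mapsto> - (\<Sum>u\<le>k. a\<^sub>u\<^sub>u) - c\<close> (\<open>pi_star_I_functional\<close>). This
  covers the strictly upper triangular matrices and the Cartan algebra at once.

  It remains to see that \<open>I\<^sub>k \<noteq> 0\<close>, for which an element of the eigenspace is needed. With the
  Gaussian \<open>G(x) = exp(-\<pi>|x|\<^sup>2)\<close>, for which \<open>T\<^sub>J G = G\<close> wherever \<open>x\<^sub>-\<^sub>1 = 0\<close>, the function
  \<open>G(x) (1 + 2\<pi>(\<lambda>-1) \<Sum>i\<ge>0. \<lambda>\<^sup>i (x\<^sup>k\<^bsub>-i-1\<^esub>)\<^sup>2)\<close> satisfies \<open>(T\<^sub>J f)(0, x) = \<lambda> f(x)\<close> for every \<open>J\<close>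
  that contains \<open>k\<close>: shifting the sum produces a factor \<open>\<lambda>\<close>, and the second moment \<open>1/(2\<pi>)\<close> of the
  new coordinate turns the constant \<open>1\<close> into \<open>1 + (\<lambda>-1) = \<lambda>\<close>. So it lies in the eigenspace, and
  \<open>I\<^sub>k\<close> takes the value \<open>\<lambda> \<noteq> 0\<close> on it.\<close>

section \<open>Differentiation under the integral sign\<close>

lemma has_vector_derivative_iff_quotient:
  fixes f :: "real \<Rightarrow> 'a::real_normed_vector"
  shows "(f has_vector_derivative D) (at 0) \<longleftrightarrow> ((\<lambda>h. (f h - f 0) /\<^sub>R h) \<longlongrightarrow> D) (at 0)"
proof -
  have eq: "norm (f h - f 0 - h *\<^sub>R D) / norm h = norm ((f h - f 0) /\<^sub>R h - D)" if "h \<noteq> 0" for h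
  proof -
    have "(f h - f 0) /\<^sub>R h - D = (f h - f 0 - h *\<^sub>R D) /\<^sub>R h"
      using that by (simp add: scaleR_diff_right)
    then show ?thesis by (simp add: divide_inverse mult.commute)
  qed
  have "(f has_vector_derivative D) (at 0) \<longleftrightarrow>
        ((\<lambda>h. norm (f h - f 0 - h *\<^sub>R D) / norm h) \<longlongrightarrow> 0) (at 0)"
    by (simp add: has_vector_derivative_def has_derivative_at bounded_linear_scaleR_left)
  also have "\<dots> \<longleftrightarrow> ((\<lambda>h. norm ((f h - f 0) /\<^sub>R h - D)) \<longlongrightarrow> 0) (at 0)"
    by (rule filterlim_cong[OF refl refl]) (use eq in \<open>simp add: eventually_at_filter\<close>)
  also have "\<dots> \<longleftrightarrow> ((\<lambda>h. (f h - f 0) /\<^sub>R h) \<longlongrightarrow> D) (at 0)"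
    by (simp only: tendsto_norm_zero_iff LIM_zero_iff)
  finally show ?thesis .
qed

text \<open>The mean value inequality turns the bound on the derivatives into a bound on the difference
  quotients, to which dominated convergence applies.\<close>

lemma has_vector_derivative_lebesgue_integral:
  fixes F F' :: "real \<Rightarrow> 'a \<Rightarrow> 'b::euclidean_space"
  assumes deriv: "\<And>s y. y \<in> space M \<Longrightarrow> ((\<lambda>s. F s y) has_vector_derivative F' s y) (at s)"
    and int: "\<And>s. integrable M (F s)"
    and F'0: "F' 0 \<in> borel_measurable M"
    and bound: "\<And>s y. \<bar>s\<bar> \<le> 1 \<Longrightarrow> y \<in> space M \<Longrightarrow> norm (F' s y) \<le> w y"
    and w: "integrable M w"
  shows "((\<lambda>s. integral\<^sup>L M (F s)) has_vector_derivative integral\<^sup>L M (F' 0)) (at 0)"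
  unfolding has_vector_derivative_iff_quotient
  unfolding tendsto_at_iff_sequentially comp_def
proof (intro allI impI)
  fix X :: "nat \<Rightarrow> real"
  assume X0: "\<forall>i. X i \<in> UNIV - {0}" and X: "X \<longlonglongrightarrow> 0"
  from X have "eventually (\<lambda>n. \<bar>X n\<bar> < 1) sequentially"
    using tendsto_rabs_zero order_tendstoD(2) zero_less_one by metis
  then obtain N where N: "\<And>n. n \<ge> N \<Longrightarrow> \<bar>X n\<bar> < 1" by (auto simp: eventually_sequentially)
  \<comment> \<open>The bound on the derivatives is available only once the sequence has entered \<open>[-1, 1]\<close>.\<close>
  define Y where "Y n = X (n + N)" for n
  have Y0: "Y n \<noteq> 0" and Y1: "\<bar>Y n\<bar> \<le> 1" for n using X0 N[of "n + N"] by (auto simp: Y_def)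
  have Y: "Y \<longlonglongrightarrow> 0" using LIMSEQ_ignore_initial_segment[OF X] by (simp add: Y_def[abs_def])
  have "(\<lambda>n. integral\<^sup>L M (\<lambda>y. (F (Y n) y - F 0 y) /\<^sub>R Y n)) \<longlonglongrightarrow> integral\<^sup>L M (F' 0)"
  proof (rule integral_dominated_convergence[where w = w])
    show "AE y in M. (\<lambda>n. (F (Y n) y - F 0 y) /\<^sub>R Y n) \<longlonglongrightarrow> F' 0 y"
    proof (rule AE_I2)
      fix y assume "y \<in> space M"
      then have "((\<lambda>h. (F h y - F 0 y) /\<^sub>R h) \<longlongrightarrow> F' 0 y) (at 0)"
        by (rule has_vector_derivative_iff_quotient[THEN iffD1, OF deriv])
      with Y Y0 show "(\<lambda>n. (F (Y n) y - F 0 y) /\<^sub>R Y n) \<longlonglongrightarrow> F' 0 y"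
        unfolding tendsto_at_iff_sequentially comp_def by auto
    qed
    show "AE y in M. norm ((F (Y n) y - F 0 y) /\<^sub>R Y n) \<le> w y" for n
    proof (rule AE_I2)
      fix y assume y: "y \<in> space M"
      have "norm (F (Y n) y - F 0 y) \<le> w y * norm (Y n - 0)"
      proof (rule differentiable_bound[where S = "{-1..1}" and f' = "\<lambda>s h. h *\<^sub>R F' s y"])
        show "((\<lambda>s. F s y) has_derivative (\<lambda>h. h *\<^sub>R F' s y)) (at s within {-1..1})" for s
          using deriv[OF y] by (simp add: has_vector_derivative_def has_derivative_at_withinI)
        show "onorm (\<lambda>h. h *\<^sub>R F' s y) \<le> w y" if "s \<in> {-1..1}" for s
          using that y by (intro onorm_le) (auto simp: mult.commute intro!: mult_left_mono bound)
      qed (use Y1[of n] in \<open>auto simp: abs_le_iff\<close>)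
      moreover have "norm ((F (Y n) y - F 0 y) /\<^sub>R Y n) = norm (F (Y n) y - F 0 y) / \<bar>Y n\<bar>"
        by (simp add: divide_inverse mult.commute)
      ultimately show "norm ((F (Y n) y - F 0 y) /\<^sub>R Y n) \<le> w y"
        using Y0[of n] by (simp add: pos_divide_le_eq)
    qed
    show "(\<lambda>y. (F (Y n) y - F 0 y) /\<^sub>R Y n) \<in> borel_measurable M" for n
      using int by (intro borel_measurable_scaleR borel_measurable_diff) auto
  qed (use F'0 w in auto)
  then have "(\<lambda>n. (integral\<^sup>L M (F (Y n)) - integral\<^sup>L M (F 0)) /\<^sub>R Y n) \<longlonglongrightarrow> integral\<^sup>L M (F' 0)"
    using int by simp
  then show "(\<lambda>n. (integral\<^sup>L M (F (X n)) - integral\<^sup>L M (F 0)) /\<^sub>R X n) \<longlonglongrightarrow> integral\<^sup>L M (F' 0)"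
    unfolding Y_def by (rule LIMSEQ_offset)
qed

section \<open>Schwartz functions on a subspace\<close>

text \<open>The condition that a Schwartz function imposes on each of its iterated derivatives.\<close>

definition rapid_on :: "'a::real_normed_vector set \<Rightarrow> ('a \<Rightarrow> complex) \<Rightarrow> bool" where
  "rapid_on V f \<longleftrightarrow>
     (\<forall>x\<in>V. \<forall>v\<in>V. (\<lambda>s::real. f (x + s *\<^sub>R v)) differentiable at 0) \<and>
     continuous_on V f \<and>
     (\<forall>m::nat. \<exists>C. \<forall>x\<in>V. norm x ^ m * norm (f x) \<le> C)"

lemma schwartz_on_iff_rapid_on:
  "schwartz_on V f \<longleftrightarrow> (\<forall>vs. set vs \<subseteq> V \<longrightarrow> rapid_on V (iter_deriv vs f))"
  unfolding schwartz_on_def rapid_on_def by blast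

lemma schwartz_on_imp_rapid_on: "schwartz_on V f \<Longrightarrow> rapid_on V f"
  using schwartz_on_iff_rapid_on[of V f] by (auto simp: iter_deriv_def dest: spec[of _ "[]"])

lemma schwartz_on_dir_deriv:
  assumes "schwartz_on V f" "v \<in> V"
  shows "schwartz_on V (dir_deriv v f)"
  unfolding schwartz_on_iff_rapid_on
proof (intro allI impI)
  fix vs assume "set vs \<subseteq> V"
  then have "rapid_on V (iter_deriv (vs @ [v]) f)"
    using assms by (simp add: schwartz_on_iff_rapid_on)
  then show "rapid_on V (iter_deriv vs (dir_deriv v f))"
    by (simp add: iter_deriv_def)
qed

lemma schwartz_on_subset: "schwartz_on W f \<Longrightarrow> V \<subseteq> W \<Longrightarrow> schwartz_on V f"
  unfolding schwartz_on_def by (meson continuous_on_subset subset_iff)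

lemma rapid_on_has_vector_derivative:
  assumes "rapid_on V f" "x \<in> V" "v \<in> V"
  shows "((\<lambda>s. f (x + s *\<^sub>R v)) has_vector_derivative dir_deriv v f x) (at 0)"
  using assms unfolding rapid_on_def dir_deriv_def
  by (simp add: vector_derivative_works[symmetric])

lemma dir_deriv_cong:
  assumes "subspace V" "x \<in> V" "v \<in> V" "\<And>x. x \<in> V \<Longrightarrow> f x = g x"
  shows "dir_deriv v f x = dir_deriv v g x"
proof -
  have "f (x + s *\<^sub>R v) = g (x + s *\<^sub>R v)" for s :: real
    using assms by (simp add: subspace_add subspace_scale)
  then show ?thesis by (simp add: dir_deriv_def)
qed

lemma rapid_on_cong:
  assumes V: "subspace V" and f: "rapid_on V f" and eq: "\<And>x. x \<in> V \<Longrightarrow> f x = g x"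
  shows "rapid_on V g"
proof -
  have "f (x + s *\<^sub>R v) = g (x + s *\<^sub>R v)" if "x \<in> V" "v \<in> V" for x v and s :: real
    using that V by (simp add: eq subspace_add subspace_scale)
  with f eq show ?thesis
    unfolding rapid_on_def by (auto cong: continuous_on_cong)
qed

lemma dir_deriv_eqI:
  "((\<lambda>s. f (x + s *\<^sub>R v)) has_vector_derivative D) (at 0) \<Longrightarrow> dir_deriv v f x = D"
  unfolding dir_deriv_def by (rule vector_derivative_at)

lemma has_vector_derivative_line_add:
  assumes "rapid_on V f" "rapid_on V g" "x \<in> V" "v \<in> V"
  shows "((\<lambda>s. f (x + s *\<^sub>R v) + g (x + s *\<^sub>R v)) has_vector_derivative
           dir_deriv v f x + dir_deriv v g x) (at 0)"
  using assms by (intro has_vector_derivative_add rapid_on_has_vector_derivative)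

lemma has_vector_derivative_line_scale:
  assumes "rapid_on V f" "x \<in> V" "v \<in> V"
  shows "((\<lambda>s. c * f (x + s *\<^sub>R v)) has_vector_derivative c * dir_deriv v f x) (at 0)"
  using rapid_on_has_vector_derivative[OF assms] by (rule has_vector_derivative_mult_right)

lemma has_vector_derivative_line_mult_linear:
  assumes "rapid_on V f" "x \<in> V" "v \<in> V" and l: "bounded_linear l"
  shows "((\<lambda>s. complex_of_real (l (x + s *\<^sub>R v)) * f (x + s *\<^sub>R v)) has_vector_derivative
           of_real (l x) * dir_deriv v f x + of_real (l v) * f x) (at 0)"
proof -
  interpret l: bounded_linear l by fact
  have "((\<lambda>s. complex_of_real (l x + s * l v)) has_vector_derivative of_real (l v)) (at 0)"
    by (auto intro!: derivative_eq_intros has_vector_derivative_of_real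
        simp flip: has_real_derivative_iff_has_vector_derivative)
  from has_vector_derivative_mult[OF this rapid_on_has_vector_derivative[OF assms(1-3)]]
  show ?thesis by (simp add: l.add l.scaleR)
qed

lemma rapid_on_add:
  assumes "rapid_on V f" "rapid_on V g"
  shows "rapid_on V (\<lambda>x. f x + g x)"
proof -
  have "\<exists>C. \<forall>x\<in>V. norm x ^ m * norm (f x + g x) \<le> C" for m
  proof -
    obtain C D where "\<forall>x\<in>V. norm x ^ m * norm (f x) \<le> C" "\<forall>x\<in>V. norm x ^ m * norm (g x) \<le> D"
      using assms unfolding rapid_on_def by metis
    moreover have "norm x ^ m * norm (f x + g x) \<le> norm x ^ m * norm (f x) + norm x ^ m * norm (g x)" for x
      by (simp flip: distrib_left add: mult_left_mono norm_triangle_ineq)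
    ultimately have "\<forall>x\<in>V. norm x ^ m * norm (f x + g x) \<le> C + D" by (meson add_mono order_trans)
    then show ?thesis ..
  qed
  moreover have "continuous_on V (\<lambda>x. f x + g x)"
    using assms by (auto simp: rapid_on_def intro: continuous_on_add)
  moreover have "(\<lambda>s::real. f (x + s *\<^sub>R v) + g (x + s *\<^sub>R v)) differentiable at 0"
    if "x \<in> V" "v \<in> V" for x v
    using has_vector_derivative_line_add[OF assms that] by (rule differentiableI_vector)
  ultimately show ?thesis by (simp add: rapid_on_def)
qed

lemma rapid_on_scale:
  assumes "rapid_on V f"
  shows "rapid_on V (\<lambda>x. c * f x)"
proof -
  have "\<exists>C. \<forall>x\<in>V. norm x ^ m * norm (c * f x) \<le> C" for m
  proof -
    obtain C where C: "\<forall>x\<in>V. norm x ^ m * norm (f x) \<le> C"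
      using assms unfolding rapid_on_def by metis
    have "norm x ^ m * norm (c * f x) \<le> norm c * C" if "x \<in> V" for x
      using mult_left_mono[OF C[rule_format, OF that], of "norm c"] by (simp add: norm_mult mult_ac)
    then show ?thesis by blast
  qed
  moreover have "continuous_on V (\<lambda>x. c * f x)"
    using assms by (auto simp: rapid_on_def intro: continuous_on_mult_left)
  moreover have "(\<lambda>s::real. c * f (x + s *\<^sub>R v)) differentiable at 0"
    if "x \<in> V" "v \<in> V" for x v
    using has_vector_derivative_line_scale[OF assms that] by (rule differentiableI_vector)
  ultimately show ?thesis by (simp add: rapid_on_def)
qed

lemma rapid_on_mult_linear:
  assumes f: "rapid_on V f" and l: "bounded_linear l"
  shows "rapid_on V (\<lambda>x. complex_of_real (l x) * f x)"
proof -
  obtain K where K: "\<And>x. norm (l x) \<le> norm x * K" using l bounded_linear.bounded by blast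
  have "\<exists>C. \<forall>x\<in>V. norm x ^ m * norm (complex_of_real (l x) * f x) \<le> C" for m
  proof -
    obtain C where C: "\<forall>x\<in>V. norm x ^ Suc m * norm (f x) \<le> C"
      using f unfolding rapid_on_def by metis
    have "norm x ^ m * norm (complex_of_real (l x) * f x) \<le> \<bar>K\<bar> * C" if "x \<in> V" for x
    proof -
      have "norm (l x) \<le> norm x * \<bar>K\<bar>"
        using K[of x] by (meson abs_ge_self mult_left_mono norm_ge_zero order_trans)
      then have "norm x ^ m * norm (complex_of_real (l x) * f x)
                 \<le> norm x ^ m * ((norm x * \<bar>K\<bar>) * norm (f x))"
        by (simp add: norm_mult mult_left_mono mult_right_mono)
      also have "\<dots> = \<bar>K\<bar> * (norm x ^ Suc m * norm (f x))" by simp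
      also have "\<dots> \<le> \<bar>K\<bar> * C" using C that by (intro mult_left_mono) auto
      finally show ?thesis .
    qed
    then show ?thesis by blast
  qed
  moreover have "continuous_on V (\<lambda>x. complex_of_real (l x) * f x)"
    using f by (auto simp: rapid_on_def intro!: continuous_intros bounded_linear.continuous_on[OF l])
  moreover have "(\<lambda>s::real. complex_of_real (l (x + s *\<^sub>R v)) * f (x + s *\<^sub>R v)) differentiable at 0"
    if "x \<in> V" "v \<in> V" for x v
    using has_vector_derivative_line_mult_linear[OF f that l] by (rule differentiableI_vector)
  ultimately show ?thesis by (simp add: rapid_on_def)
qed

text \<open>Up to equality on \<open>V\<close>, this is the module generated by \<open>F\<close> over the polynomial functions.\<close>

inductive_set poly_module :: "'a::real_normed_vector set \<Rightarrow> ('a \<Rightarrow> complex) set \<Rightarrow> ('a \<Rightarrow> complex) set"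
  for V F where
  base: "f \<in> F \<Longrightarrow> f \<in> poly_module V F"
| add: "f \<in> poly_module V F \<Longrightarrow> g \<in> poly_module V F \<Longrightarrow> (\<lambda>x. f x + g x) \<in> poly_module V F"
| scale: "f \<in> poly_module V F \<Longrightarrow> (\<lambda>x. c * f x) \<in> poly_module V F"
| mult_linear: "f \<in> poly_module V F \<Longrightarrow> bounded_linear l \<Longrightarrow>
    (\<lambda>x. complex_of_real (l x) * f x) \<in> poly_module V F"
| cong: "f \<in> poly_module V F \<Longrightarrow> (\<And>x. x \<in> V \<Longrightarrow> f x = g x) \<Longrightarrow> g \<in> poly_module V F"

text \<open>A coinduction principle. If differentiation maps \<open>F\<close> into the module that \<open>F\<close> generates, then by
  the product rule it maps this module into itself; as multiplication by a linear function preserves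
  rapid decay, all iterated derivatives of its elements decrease rapidly. The closure
  properties of the Schwartz space and the fact that the Gaussian belongs to it are all instances.\<close>

lemma schwartz_on_poly_module:
  assumes V: "subspace V"
    and F: "\<And>f. f \<in> F \<Longrightarrow> rapid_on V f"
    and dF: "\<And>f v. f \<in> F \<Longrightarrow> v \<in> V \<Longrightarrow> dir_deriv v f \<in> poly_module V F"
    and f: "f \<in> poly_module V F"
  shows "schwartz_on V f"
proof -
  have step: "rapid_on V f \<and> (\<forall>v\<in>V. dir_deriv v f \<in> poly_module V F)"
    if "f \<in> poly_module V F" for f
    using that
  proof induction
    case (base f)
    then show ?case using F dF by blast
  next
    case (add f g)
    have "dir_deriv v (\<lambda>x. f x + g x) x = dir_deriv v f x + dir_deriv v g x" if "x \<in> V" "v \<in> V" for x v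
      using add.IH that by (intro dir_deriv_eqI has_vector_derivative_line_add) auto
    then show ?case using add.IH
      by (auto intro!: rapid_on_add intro: poly_module.cong[OF poly_module.add])
  next
    case (scale f c)
    have "dir_deriv v (\<lambda>x. c * f x) x = c * dir_deriv v f x" if "x \<in> V" "v \<in> V" for x v
      using scale.IH that by (intro dir_deriv_eqI has_vector_derivative_line_scale) auto
    then show ?case using scale.IH
      by (auto intro!: rapid_on_scale intro: poly_module.cong[OF poly_module.scale])
  next
    case (mult_linear f l)
    have eq: "of_real (l x) * dir_deriv v f x + of_real (l v) * f x
        = dir_deriv v (\<lambda>x. complex_of_real (l x) * f x) x" if "x \<in> V" "v \<in> V" for x v
      using mult_linear that
      by (intro dir_deriv_eqI[symmetric] has_vector_derivative_line_mult_linear) auto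
    have "dir_deriv v (\<lambda>x. complex_of_real (l x) * f x) \<in> poly_module V F" if "v \<in> V" for v
      using mult_linear that
      by (intro poly_module.cong[OF poly_module.add[OF poly_module.mult_linear poly_module.scale] eq]) auto
    with mult_linear show ?case by (auto intro!: rapid_on_mult_linear)
  next
    case (cong f g)
    then show ?case
      by (auto intro: rapid_on_cong[OF V] poly_module.cong dir_deriv_cong[OF V])
  qed
  have "iter_deriv vs f \<in> poly_module V F" if "set vs \<subseteq> V" for vs
    using that f by (induction vs) (auto simp: iter_deriv_def step)
  then show ?thesis using step by (auto simp: schwartz_on_iff_rapid_on)
qed

section \<open>The Schwartz space of the sequence space\<close>

lemma schwartz_space_dir_deriv:
  assumes "f \<in> schwartz_space"
  shows "dir_deriv v f \<in> schwartz_space"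
  unfolding schwartz_space_def
proof (intro CollectI allI impI)
  fix B :: "'a rminus set" assume "finite B"
  then have "schwartz_on (span (insert v B)) (dir_deriv v f)"
    using assms by (intro schwartz_on_dir_deriv) (auto simp: schwartz_space_def span_base)
  then show "schwartz_on (span B) (dir_deriv v f)"
    by (rule schwartz_on_subset) (intro span_mono subset_insertI)
qed

lemma schwartz_space_closed:
  assumes "\<And>V. subspace V \<Longrightarrow> g \<in> poly_module V schwartz_space"
  shows "g \<in> schwartz_space"
  unfolding schwartz_space_def
proof (intro CollectI allI impI)
  fix B :: "'a rminus set" assume B: "finite B"
  show "schwartz_on (span B) g"
  proof (rule schwartz_on_poly_module[where F = schwartz_space])
    show "rapid_on (span B) f" if "f \<in> schwartz_space" for f
      using that B by (auto simp: schwartz_space_def intro: schwartz_on_imp_rapid_on)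
    show "dir_deriv v f \<in> poly_module (span B) schwartz_space" if "f \<in> schwartz_space" for f v
      using that by (intro poly_module.base schwartz_space_dir_deriv)
  qed (simp_all add: assms)
qed

lemma schwartz_space_add:
  "f \<in> schwartz_space \<Longrightarrow> g \<in> schwartz_space \<Longrightarrow> (\<lambda>x. f x + g x) \<in> schwartz_space"
  by (rule schwartz_space_closed, rule poly_module.add) (simp_all add: poly_module.base)

lemma schwartz_space_scale: "f \<in> schwartz_space \<Longrightarrow> (\<lambda>x. c * f x) \<in> schwartz_space"
  by (rule schwartz_space_closed, rule poly_module.scale) (simp_all add: poly_module.base)

lemma schwartz_space_mult_linear:
  "f \<in> schwartz_space \<Longrightarrow> bounded_linear l \<Longrightarrow> (\<lambda>x. complex_of_real (l x) * f x) \<in> schwartz_space"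
  by (rule schwartz_space_closed, rule poly_module.mult_linear) (simp_all add: poly_module.base)

text \<open>On a finite-dimensional subspace the infinite sums below are finite, so they can be treated
  as finite sums of Schwartz functions.\<close>

lemma schwartz_spaceI_local:
  assumes "\<And>B. finite B \<Longrightarrow> \<exists>g\<in>schwartz_space. \<forall>x\<in>span B. g x = f x"
  shows "f \<in> schwartz_space"
  unfolding schwartz_space_def
proof (intro CollectI allI impI)
  fix B :: "'a rminus set" assume B: "finite B"
  then obtain g where g: "schwartz_on (span B) g" and eq: "\<And>x. x \<in> span B \<Longrightarrow> g x = f x"
    using assms[OF B] unfolding schwartz_space_def by blast
  have "f \<in> poly_module (span B) {f. schwartz_on (span B) f}"
    by (rule poly_module.cong[OF poly_module.base eq]) (use g in auto)
  then show "schwartz_on (span B) f"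
    by (rule schwartz_on_poly_module[rotated -1])
      (auto simp: schwartz_on_imp_rapid_on intro: poly_module.base schwartz_on_dir_deriv)
qed

lemma rapid_on_zero: "rapid_on V (\<lambda>x. 0)"
  by (auto simp: rapid_on_def)

lemma schwartz_space_zero: "(\<lambda>x. 0) \<in> schwartz_space"
proof -
  have [simp]: "iter_deriv vs (\<lambda>x. 0) = (\<lambda>x::'a rminus. 0)" for vs
    by (induction vs) (auto simp: iter_deriv_def dir_deriv_def fun_eq_iff)
  show ?thesis by (auto simp: schwartz_space_def schwartz_on_iff_rapid_on rapid_on_zero)
qed

lemma schwartz_space_sum:
  assumes "\<And>i. i \<in> I \<Longrightarrow> f i \<in> schwartz_space"
  shows "(\<lambda>x. \<Sum>i\<in>I. f i x) \<in> schwartz_space"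
  using assms by (induction I rule: infinite_finite_induct)
    (auto simp: schwartz_space_zero intro: schwartz_space_add)

lemma schwartz_space_rapid_on_span:
  "f \<in> schwartz_space \<Longrightarrow> finite B \<Longrightarrow> rapid_on (span B) f"
  by (auto simp: schwartz_space_def intro: schwartz_on_imp_rapid_on)

lemma schwartz_space_rapid_on_line:
  assumes "f \<in> schwartz_space"
  obtains V where "rapid_on V f" "x \<in> V" "v \<in> V" "x + r *\<^sub>R v \<in> V"
proof
  have x: "x \<in> span {x, v}" and v: "v \<in> span {x, v}" by (rule span_base, simp)+
  then show "x \<in> span {x, v}" "v \<in> span {x, v}" "x + r *\<^sub>R v \<in> span {x, v}"
    by (blast intro: span_add span_scale)+
  show "rapid_on (span {x, v}) f"
    using assms by (rule schwartz_space_rapid_on_span) simp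
qed

lemma schwartz_space_has_vector_derivative:
  assumes "f \<in> schwartz_space"
  shows "((\<lambda>s. f (x + s *\<^sub>R v)) has_vector_derivative dir_deriv v f (x + r *\<^sub>R v)) (at r)"
proof -
  obtain V where "rapid_on V f" "x + r *\<^sub>R v \<in> V" "v \<in> V"
    using schwartz_space_rapid_on_line[OF assms] by blast
  from rapid_on_has_vector_derivative[OF this]
  have "((\<lambda>s. f (x + r *\<^sub>R v + s *\<^sub>R v)) has_vector_derivative dir_deriv v f (x + r *\<^sub>R v)) (at (r - r))"
    by simp
  moreover have "((\<lambda>s. s - r) has_vector_derivative 1) (at r)"
    by (auto intro!: derivative_eq_intros simp flip: has_real_derivative_iff_has_vector_derivative)
  ultimately have "(((\<lambda>s. f (x + r *\<^sub>R v + s *\<^sub>R v)) \<circ> (\<lambda>s. s - r)) has_vector_derivative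
      1 *\<^sub>R dir_deriv v f (x + r *\<^sub>R v)) (at r)"
    by (intro vector_diff_chain_at)
  moreover have "(\<lambda>s. f (x + r *\<^sub>R v + s *\<^sub>R v)) \<circ> (\<lambda>s. s - r) = (\<lambda>s. f (x + s *\<^sub>R v))"
    by (simp add: fun_eq_iff scaleR_left_diff_distrib)
  ultimately show ?thesis by simp
qed

lemma dir_deriv_mult_linear:
  assumes f: "f \<in> schwartz_space" and l: "bounded_linear l"
  shows "dir_deriv v (\<lambda>x. complex_of_real (l x) * f x) x = of_real (l x) * dir_deriv v f x + of_real (l v) * f x"
proof -
  obtain V where V: "rapid_on V f" "x \<in> V" "v \<in> V"
    using schwartz_space_rapid_on_line[OF f] by blast
  show ?thesis
    by (rule dir_deriv_eqI[OF has_vector_derivative_line_mult_linear[OF V l]])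
qed

lemma dir_deriv_scale:
  assumes f: "f \<in> schwartz_space"
  shows "dir_deriv v (\<lambda>x. c * f x) x = c * dir_deriv v f x"
proof -
  obtain V where V: "rapid_on V f" "x \<in> V" "v \<in> V"
    using schwartz_space_rapid_on_line[OF f] by blast
  show ?thesis
    by (rule dir_deriv_eqI[OF has_vector_derivative_line_scale[OF V]])
qed

section \<open>Coordinates on the sequence space\<close>

lemma lookup_scaleR [simp]:
  "Poly_Mapping.lookup (r *\<^sub>R x) i = r *\<^sub>R Poly_Mapping.lookup x i"
proof -
  have "finite {i. r *\<^sub>R Poly_Mapping.lookup x i \<noteq> 0}"
    by (rule finite_subset[OF _ finite_keys[of x]]) (auto simp: in_keys_iff)
  then show ?thesis by (simp add: scaleR_poly_mapping_def)
qed

lemma norm_rminus_eq: "norm x = (\<Sum>i\<in>Poly_Mapping.keys x. norm (Poly_Mapping.lookup x i))"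
  by (simp add: norm_poly_mapping_def dist_poly_mapping_def)

lemma norm_lookup_le: "norm (Poly_Mapping.lookup x i) \<le> norm x"
proof (cases "i \<in> Poly_Mapping.keys x")
  case True
  then show ?thesis unfolding norm_rminus_eq by (intro member_le_sum) auto
qed (simp add: in_keys_iff)

lemma bounded_linear_lookup: "bounded_linear (\<lambda>x. Poly_Mapping.lookup x i)"
  by (rule bounded_linear_intro[of _ 1]) (auto simp: lookup_add norm_lookup_le)

lemma bounded_linear_coord: "bounded_linear (\<lambda>x::'n::finite rminus. Poly_Mapping.lookup x i $ j)"
  using bounded_linear_compose[OF bounded_linear_vec_nth bounded_linear_lookup] .

lemma prepend_add: "prepend (y + y') (x + x') = prepend y x + prepend y' x'"
  by (rule poly_mapping_eqI) (simp add: prepend.rep_eq lookup_add split: nat.split)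

lemma prepend_scaleR: "prepend (r *\<^sub>R y) (r *\<^sub>R x) = r *\<^sub>R prepend y x"
  by (rule poly_mapping_eqI) (simp add: prepend.rep_eq split: nat.split)

lemma prepend_zero: "prepend y 0 = Poly_Mapping.single 0 y"
  by (rule poly_mapping_eqI) (simp add: prepend.rep_eq lookup_single split: nat.split)

lemma prepend_zero_single: "prepend 0 (Poly_Mapping.single i a) = Poly_Mapping.single (Suc i) a"
  by (rule poly_mapping_eqI) (simp add: prepend.rep_eq lookup_single when_def split: nat.split)

lemma prepend_split: "prepend y x = Poly_Mapping.single 0 y + prepend 0 x"
  using prepend_add[of y 0 0 x] by (simp add: prepend_zero)

lemma bounded_linear_single: "bounded_linear (Poly_Mapping.single i)"
proof (rule bounded_linear_intro[of _ 1])
  show "norm (Poly_Mapping.single i x) \<le> norm x * 1" for x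
    unfolding norm_rminus_eq by (cases "x = 0") auto
qed (auto simp: single_add intro!: poly_mapping_eqI simp: lookup_single when_def)

lemma single_in_span:
  fixes y :: "real ^ 'n::finite"
  assumes "range (\<lambda>j. Poly_Mapping.single i (axis j 1)) \<subseteq> B"
  shows "Poly_Mapping.single i y \<in> span B"
proof -
  interpret s: bounded_linear "Poly_Mapping.single i :: real ^ 'n \<Rightarrow> _ \<Rightarrow>\<^sub>0 real ^ 'n"
    by (rule bounded_linear_single)
  have "y = (\<Sum>j\<in>UNIV. y $ j *\<^sub>R axis j 1)"
    using basis_expansion[of y] by (simp add: scalar_mult_eq_scaleR)
  then have "Poly_Mapping.single i y = Poly_Mapping.single i (\<Sum>j\<in>UNIV. y $ j *\<^sub>R axis j 1)"
    by (rule arg_cong)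
  also have "\<dots> = (\<Sum>j\<in>UNIV. y $ j *\<^sub>R Poly_Mapping.single i (axis j 1))"
    by (simp only: s.sum s.scaleR)
  also have "\<dots> \<in> span B" using assms by (intro span_sum span_scale span_base) auto
  finally show ?thesis .
qed

lemma span_bounded_support:
  fixes B :: "'n::finite rminus set"
  assumes "finite B"
  obtains N where "\<And>x i. x \<in> span B \<Longrightarrow> N \<le> i \<Longrightarrow> Poly_Mapping.lookup x i = 0"
proof
  define N where "N = Suc (Max (insert 0 (\<Union>x\<in>B. Poly_Mapping.keys x)))"
  have B: "Poly_Mapping.lookup x i = 0" if "x \<in> B" "N \<le> i" for x i
  proof (rule ccontr)
    assume "Poly_Mapping.lookup x i \<noteq> 0"
    then have "i \<in> insert 0 (\<Union>x\<in>B. Poly_Mapping.keys x)" using that by (auto simp: in_keys_iff)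
    then have "i \<le> Max (insert 0 (\<Union>x\<in>B. Poly_Mapping.keys x))"
      using assms by (intro Max_ge) auto
    with that show False by (simp add: N_def)
  qed
  show "Poly_Mapping.lookup x i = 0" if "x \<in> span B" "N \<le> i" for x i
    using that(1) by (induction rule: span_induct_alt) (auto simp: lookup_add B that)
qed

section \<open>Integration over the first coordinates\<close>

definition embed_vec :: "'n set \<Rightarrow> ('n \<Rightarrow> real) \<Rightarrow> real ^ 'n::finite" where
  "embed_vec J y = (\<chi> j. if j \<in> J then y j else 0)"

text \<open>The base point \<open>z\<close> is an arbitrary element and not one of the form \<open>(0, x)\<close>, so that
  derivatives in all directions, including those of the fibre, can be compared with the integral.\<close>

definition fiber_integral :: "'n::finite set \<Rightarrow> ('n rminus \<Rightarrow> complex) \<Rightarrow> 'n rminus \<Rightarrow> complex" where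
  "fiber_integral J f z =
     (LINT y|Pi\<^sub>M J (\<lambda>_. lborel). f (Poly_Mapping.single 0 (embed_vec J y) + z))"

lemma embed_vec_measurable [measurable]:
  "embed_vec J \<in> borel_measurable (Pi\<^sub>M J (\<lambda>_. lborel))"
proof -
  have "embed_vec J y = (\<Sum>j\<in>J. y j *\<^sub>R axis j 1)" for y
    by (simp add: vec_eq_iff embed_vec_def axis_def if_distrib sum.delta cong: if_cong)
  then have "embed_vec J = (\<lambda>y. \<Sum>j\<in>J. y j *\<^sub>R axis j 1)" by blast
  then show ?thesis by simp
qed

interpretation lborel_PiM: product_sigma_finite "\<lambda>_::'n. lborel :: real measure"
  by (simp add: product_sigma_finite_def lborel.sigma_finite_measure_axioms)

text \<open>This brings \<open>\<pi>\<^sub>t\<close>, which is defined with Lebesgue measure on \<open>\<real>\<^sup>n\<close>, and \<open>I\<^sub>k\<close>, which is defined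
  with a product measure, into the same form. Both measures agree on boxes.\<close>

lemma lborel_vec_eq:
  "(lborel :: (real ^ 'n::finite) measure) =
     distr (Pi\<^sub>M UNIV (\<lambda>_. lborel)) borel (embed_vec UNIV)" (is "_ = ?D")
proof (rule lborel_eqI)
  fix l u :: "real ^ 'n" assume le: "\<And>b. b \<in> Basis \<Longrightarrow> l \<bullet> b \<le> u \<bullet> b"
  then have le': "l $ j \<le> u $ j" for j
    using le[of "axis j 1"] by (simp add: axis_in_Basis_iff inner_axis)
  have "embed_vec UNIV -` box l u \<inter> space (Pi\<^sub>M UNIV (\<lambda>_. lborel)) = (\<Pi>\<^sub>E j\<in>UNIV. {l $ j<..<u $ j})"
    by (auto simp: embed_vec_def mem_box_cart space_PiM PiE_def Pi_def)
  then have "emeasure ?D (box l u) = emeasure (Pi\<^sub>M UNIV (\<lambda>_. lborel)) (\<Pi>\<^sub>E j\<in>UNIV. {l $ j<..<u $ j})"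
    by (simp add: emeasure_distr)
  also have "\<dots> = (\<Prod>j\<in>UNIV. ennreal (u $ j - l $ j))"
    using le' by (subst lborel_PiM.emeasure_PiM) auto
  also have "\<dots> = ennreal (\<Prod>j\<in>UNIV. u $ j - l $ j)"
    using le' by (simp add: prod_ennreal)
  also have "(\<Prod>j\<in>UNIV. u $ j - l $ j) = (\<Prod>b\<in>Basis. (u - l) \<bullet> b)"
  proof -
    have "bij_betw (\<lambda>j::'n. axis j (1::real)) UNIV Basis"
      by (auto simp: bij_betw_def inj_def axis_eq_axis Basis_vec_def)
    from prod.reindex_bij_betw[OF this, of "\<lambda>b. (u - l) \<bullet> b"]
    have "(\<Prod>b\<in>Basis. (u - l) \<bullet> b) = (\<Prod>j\<in>UNIV. (u - l) \<bullet> axis j 1)" by (rule sym)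
    then show ?thesis by (simp add: inner_axis)
  qed
  finally show "emeasure ?D (box l u) = ennreal (\<Prod>b\<in>Basis. (u - l) \<bullet> b)" .
qed simp

lemma schwartz_space_continuous_fiber:
  assumes f: "f \<in> schwartz_space"
  shows "continuous_on UNIV (\<lambda>y. f (Poly_Mapping.single 0 y + z))"
proof -
  define B where "B = insert z (range (\<lambda>j. Poly_Mapping.single 0 (axis j 1)))"
  have "continuous_on UNIV (\<lambda>y. Poly_Mapping.single 0 y + z)"
    by (intro continuous_intros bounded_linear.continuous_on[OF bounded_linear_single])
  moreover have "continuous_on (span B) f"
    using schwartz_space_rapid_on_span[OF f] by (simp add: rapid_on_def B_def)
  moreover have "Poly_Mapping.single 0 y + z \<in> span B" for y
    by (intro span_add single_in_span) (auto simp: B_def intro: span_base)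
  ultimately show ?thesis
    by (intro continuous_on_compose2[of "span B" f UNIV]) auto
qed

lemma pi_t_eq_fiber_integral:
  assumes "f \<in> schwartz_space"
  shows "pi_t f x = fiber_integral UNIV f (prepend 0 x)"
proof -
  have [measurable]: "(\<lambda>y. f (Poly_Mapping.single 0 y + prepend 0 x)) \<in> borel_measurable borel"
    using assms by (intro borel_measurable_continuous_onI schwartz_space_continuous_fiber)
  have "pi_t f x = (LINT y|lborel. f (Poly_Mapping.single 0 y + prepend 0 x))"
    unfolding pi_t_def by (simp flip: prepend_split)
  also have "\<dots> = fiber_integral UNIV f (prepend 0 x)"
    unfolding fiber_integral_def by (subst lborel_vec_eq, subst integral_distr) auto
  finally show ?thesis .
qed

lemma integrable_prod_inverse_1_plus_square:
  "integrable (Pi\<^sub>M J (\<lambda>_. lborel)) (\<lambda>y. \<Prod>j\<in>J. inverse (1 + (y j)\<^sup>2) :: real)" if "finite J"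
proof (rule lborel_PiM.product_integrable_prod[OF that])
  show "integrable lborel (\<lambda>s::real. inverse (1 + s\<^sup>2))"
    using integrable_inverse_1_plus_square by (simp add: set_integrable_def)
qed

text \<open>An integrable majorant, uniform in a parameter \<open>s\<close>. With \<open>z\<close> the argument of \<open>f\<close>, each \<open>\<bar>y\<^sub>j\<bar>\<close> is at
  most \<open>\<parallel>z\<parallel> + \<parallel>x\<parallel> + \<parallel>v\<parallel>\<close>, so the product of the \<open>1 + y\<^sub>j\<^sup>2\<close> is bounded by a polynomial in \<open>\<parallel>z\<parallel>\<close>, and
  \<open>f\<close> decreases faster than any such polynomial grows.\<close>

lemma schwartz_space_decay:
  assumes f: "f \<in> schwartz_space"
  obtains C where "\<And>s y. \<bar>s\<bar> \<le> 1 \<Longrightarrow>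
    norm (f (Poly_Mapping.single 0 (embed_vec J y) + x + s *\<^sub>R v)) \<le> C * (\<Prod>j\<in>J. inverse (1 + (y j)\<^sup>2))"
proof -
  define B where "B = insert v (insert x (range (\<lambda>j. Poly_Mapping.single 0 (axis j 1))))"
  define N where "N = 2 * card J"
  have "finite B" by (simp add: B_def)
  then have rapid: "\<exists>C. \<forall>z\<in>span B. norm z ^ m * norm (f z) \<le> C" for m
    using schwartz_space_rapid_on_span[OF f] by (auto simp: rapid_on_def)
  obtain C0 where C0: "\<And>z. z \<in> span B \<Longrightarrow> norm (f z) \<le> C0" using rapid[of 0] by auto
  obtain C1 where C1: "\<And>z. z \<in> span B \<Longrightarrow> norm z ^ N * norm (f z) \<le> C1" using rapid[of N] by auto
  define D where "D = 1 + norm x + norm v"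
  have D: "D \<ge> 1" by (simp add: D_def)
  have "norm (f (Poly_Mapping.single 0 (embed_vec J y) + x + s *\<^sub>R v))
        \<le> ((2 * D) ^ N * (C0 + C1)) * (\<Prod>j\<in>J. inverse (1 + (y j)\<^sup>2))" if s: "\<bar>s\<bar> \<le> 1" for s y
  proof -
    define z where "z = Poly_Mapping.single 0 (embed_vec J y) + x + s *\<^sub>R v"
    have zB: "z \<in> span B"
      unfolding z_def
      by (intro span_add span_scale single_in_span) (auto simp: B_def intro: span_base)
    have y: "1 + (y j)\<^sup>2 \<le> (D * (1 + norm z))\<^sup>2" if "j \<in> J" for j
    proof -
      have le: "\<bar>Poly_Mapping.lookup w 0 $ j\<bar> \<le> norm w" for w :: "'a rminus"
        by (rule order_trans[OF component_le_norm_cart norm_lookup_le])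
      have "y j = Poly_Mapping.lookup z 0 $ j - Poly_Mapping.lookup x 0 $ j - s * Poly_Mapping.lookup v 0 $ j"
        using that by (simp add: z_def lookup_add embed_vec_def)
      moreover have "\<bar>s * Poly_Mapping.lookup v 0 $ j\<bar> \<le> 1 * norm v"
        unfolding abs_mult using le[of v] s by (intro mult_mono) auto
      ultimately have "\<bar>y j\<bar> \<le> norm z + norm x + norm v"
        using le[of z] le[of x] by linarith
      moreover have "0 \<le> norm v * norm z" "0 \<le> norm x * norm z" by simp_all
      ultimately have "1 + \<bar>y j\<bar> \<le> D * (1 + norm z)" unfolding D_def ring_distribs by linarith
      then have "(1 + \<bar>y j\<bar>)\<^sup>2 \<le> (D * (1 + norm z))\<^sup>2" by (intro power_mono) auto
      moreover have "1 + (y j)\<^sup>2 \<le> (1 + \<bar>y j\<bar>)\<^sup>2" by (simp add: power2_sum)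
      ultimately show ?thesis by simp
    qed
    have pos: "0 < (\<Prod>j\<in>J. 1 + (y j)\<^sup>2)" by (intro prod_pos) (simp add: add_pos_nonneg)
    have "(\<Prod>j\<in>J. 1 + (y j)\<^sup>2) \<le> (\<Prod>j\<in>J. (D * (1 + norm z))\<^sup>2)"
      using y by (intro prod_mono) auto
    also have "\<dots> = D ^ N * (1 + norm z) ^ N"
      by (simp add: N_def power_mult power_mult_distrib)
    also have "(1 + norm z) ^ N \<le> (2 * max 1 (norm z)) ^ N"
      by (intro power_mono) (auto simp: max_def)
    also have "\<dots> \<le> 2 ^ N * (1 + norm z ^ N)"
      by (simp add: power_mult_distrib max_def)
    finally have "(\<Prod>j\<in>J. 1 + (y j)\<^sup>2) \<le> (2 * D) ^ N * (1 + norm z ^ N)"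
      using D by (simp add: power_mult_distrib mult_ac)
    then have "(\<Prod>j\<in>J. 1 + (y j)\<^sup>2) * norm (f z) \<le> (2 * D) ^ N * (1 + norm z ^ N) * norm (f z)"
      by (rule mult_right_mono) simp
    also have "\<dots> = (2 * D) ^ N * (norm (f z) + norm z ^ N * norm (f z))" by (simp add: algebra_simps)
    also have "\<dots> \<le> (2 * D) ^ N * (C0 + C1)"
      using C0[OF zB] C1[OF zB] D by (intro mult_left_mono add_mono) auto
    finally have "norm (f z) \<le> ((2 * D) ^ N * (C0 + C1)) / (\<Prod>j\<in>J. 1 + (y j)\<^sup>2)"
      using pos by (simp add: pos_le_divide_eq mult.commute)
    then show ?thesis
      by (simp add: z_def divide_inverse prod_inversef[symmetric] comp_def)
  qed
  then show thesis by (rule that)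
qed

lemma integrable_fiber:
  assumes f: "f \<in> schwartz_space"
  shows "integrable (Pi\<^sub>M J (\<lambda>_. lborel)) (\<lambda>y. f (Poly_Mapping.single 0 (embed_vec J y) + z))"
proof -
  obtain C where C: "\<And>s y. \<bar>s\<bar> \<le> 1 \<Longrightarrow>
    norm (f (Poly_Mapping.single 0 (embed_vec J y) + z + s *\<^sub>R 0)) \<le> C * (\<Prod>j\<in>J. inverse (1 + (y j)\<^sup>2))"
    using schwartz_space_decay[OF f] by blast
  show ?thesis
  proof (rule Bochner_Integration.integrable_bound)
    show "integrable (Pi\<^sub>M J (\<lambda>_. lborel)) (\<lambda>y. C * (\<Prod>j\<in>J. inverse (1 + (y j)\<^sup>2)))"
      by (intro integrable_mult_right integrable_prod_inverse_1_plus_square) simp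
    show "AE y in Pi\<^sub>M J (\<lambda>_. lborel). norm (f (Poly_Mapping.single 0 (embed_vec J y) + z))
            \<le> norm (C * (\<Prod>j\<in>J. inverse (1 + (y j)\<^sup>2)))"
    proof (rule AE_I2)
      fix y
      show "norm (f (Poly_Mapping.single 0 (embed_vec J y) + z)) \<le> norm (C * (\<Prod>j\<in>J. inverse (1 + (y j)\<^sup>2)))"
        using order_trans[OF C[of 0 y] abs_ge_self] by simp
    qed
    show "(\<lambda>y. f (Poly_Mapping.single 0 (embed_vec J y) + z)) \<in> borel_measurable (Pi\<^sub>M J (\<lambda>_. lborel))"
      by (rule measurable_compose[OF embed_vec_measurable
          borel_measurable_continuous_onI[OF schwartz_space_continuous_fiber[OF f]]])
  qed
qed

lemma fiber_integral_has_vector_derivative: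
  assumes f: "f \<in> schwartz_space"
  shows "((\<lambda>s. fiber_integral J f (z + s *\<^sub>R v)) has_vector_derivative fiber_integral J (dir_deriv v f) z) (at 0)"
proof -
  have df: "dir_deriv v f \<in> schwartz_space" by (rule schwartz_space_dir_deriv[OF f])
  obtain C where C: "\<And>s y. \<bar>s\<bar> \<le> 1 \<Longrightarrow>
    norm (dir_deriv v f (Poly_Mapping.single 0 (embed_vec J y) + z + s *\<^sub>R v)) \<le> C * (\<Prod>j\<in>J. inverse (1 + (y j)\<^sup>2))"
    using schwartz_space_decay[OF df] by blast
  let ?F = "\<lambda>g s y. g (Poly_Mapping.single 0 (embed_vec J y) + z + s *\<^sub>R v) :: complex"
  have "((\<lambda>s. integral\<^sup>L (Pi\<^sub>M J (\<lambda>_. lborel)) (?F f s)) has_vector_derivative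
           integral\<^sup>L (Pi\<^sub>M J (\<lambda>_. lborel)) (?F (dir_deriv v f) 0)) (at 0)"
  proof (rule has_vector_derivative_lebesgue_integral)
    show "((\<lambda>s. ?F f s y) has_vector_derivative ?F (dir_deriv v f) s y) (at s)" for s y
      by (rule schwartz_space_has_vector_derivative[OF f])
    show "integrable (Pi\<^sub>M J (\<lambda>_. lborel)) (?F f s)" for s
      using integrable_fiber[OF f, of J "z + s *\<^sub>R v"] by (simp add: add.assoc)
    show "?F (dir_deriv v f) 0 \<in> borel_measurable (Pi\<^sub>M J (\<lambda>_. lborel))"
      using integrable_fiber[OF df, of J z] by simp
    show "norm (?F (dir_deriv v f) s y) \<le> C * (\<Prod>j\<in>J. inverse (1 + (y j)\<^sup>2))" if "\<bar>s\<bar> \<le> 1" for s y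
      using C[OF that] .
    show "integrable (Pi\<^sub>M J (\<lambda>_. lborel)) (\<lambda>y. C * (\<Prod>j\<in>J. inverse (1 + (y j)\<^sup>2)))"
      by (intro integrable_mult_right integrable_prod_inverse_1_plus_square) simp
  qed
  then show ?thesis by (simp add: fiber_integral_def add.assoc)
qed

lemma fiber_integral_dir_deriv:
  "f \<in> schwartz_space \<Longrightarrow> fiber_integral J (dir_deriv v f) z = dir_deriv v (fiber_integral J f) z"
  by (rule dir_deriv_eqI[OF fiber_integral_has_vector_derivative, symmetric])

text \<open>By Fubini the coordinate \<open>u\<close> can be integrated first, and Lebesgue measure on the line is invariant
  under translations.\<close>

lemma fiber_integral_translate:
  assumes f: "f \<in> schwartz_space" and u: "u \<in> J"
  shows "fiber_integral J f (z + s *\<^sub>R Poly_Mapping.single 0 (axis u 1)) = fiber_integral J f z"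
proof -
  define I where "I = J - {u}"
  have J: "J = insert u I" and uI: "u \<notin> I" using u by (auto simp: I_def)
  let ?f = "\<lambda>y. f (Poly_Mapping.single 0 (embed_vec J y) + z)"
  have shift: "Poly_Mapping.single 0 (embed_vec J (y(u := r))) + (z + s *\<^sub>R Poly_Mapping.single 0 (axis u 1))
      = Poly_Mapping.single 0 (embed_vec J (y(u := s + 1 * r))) + z" for y and r :: real
    by (rule poly_mapping_eqI)
      (auto simp: lookup_add lookup_single when_def embed_vec_def vec_eq_iff axis_def u)
  have "fiber_integral J f (z + s *\<^sub>R Poly_Mapping.single 0 (axis u 1))
      = (LINT y|Pi\<^sub>M I (\<lambda>_. lborel). LINT r|lborel. ?f (y(u := s + 1 * r)))"
    unfolding fiber_integral_def
    using lborel_PiM.product_integral_insert[OF finite uI, folded J, OF integrable_fiber[OF f]]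
    by (simp only: shift)
  also have "\<dots> = (LINT y|Pi\<^sub>M I (\<lambda>_. lborel). LINT r|lborel. ?f (y(u := r)))"
  proof -
    have "(LINT r|lborel. ?f (y(u := s + 1 * r))) = (LINT r|lborel. ?f (y(u := r)))" for y
      using lborel_integral_real_affine[of 1 "\<lambda>r. ?f (y(u := r))" s] by simp
    then show ?thesis by (simp only:)
  qed
  also have "\<dots> = fiber_integral J f z"
    unfolding fiber_integral_def
    using lborel_PiM.product_integral_insert[OF finite uI, folded J, OF integrable_fiber[OF f]]
    by (simp only:)
  finally show ?thesis .
qed

text \<open>The integral of a derivative is the derivative of an integral that is constant in this
  direction. No boundary terms have to be discussed.\<close>

lemma fiber_integral_partial_x:
  assumes "f \<in> schwartz_space" "u \<in> J"
  shows "fiber_integral J (partial_x 0 u f) z = 0"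
  unfolding partial_x_def fiber_integral_dir_deriv[OF assms(1)]
  by (rule dir_deriv_eqI) (simp add: fiber_integral_translate[OF assms])

lemma fiber_integral_add:
  assumes "f \<in> schwartz_space" "g \<in> schwartz_space"
  shows "fiber_integral J (\<lambda>x. f x + g x) z = fiber_integral J f z + fiber_integral J g z"
  unfolding fiber_integral_def by (intro Bochner_Integration.integral_add integrable_fiber assms)

lemma fiber_integral_scale: "fiber_integral J (\<lambda>x. c * f x) z = c * fiber_integral J f z"
  by (simp add: fiber_integral_def)

lemma fiber_integral_sum:
  assumes "\<And>i. i \<in> I \<Longrightarrow> f i \<in> schwartz_space"
  shows "fiber_integral J (\<lambda>x. \<Sum>i\<in>I. f i x) z = (\<Sum>i\<in>I. fiber_integral J (f i) z)"
  unfolding fiber_integral_def by (intro Bochner_Integration.integral_sum integrable_fiber assms)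

lemma fiber_integral_coord_const:
  assumes "i > 0 \<or> v \<notin> J"
  shows "fiber_integral J (\<lambda>x. complex_of_real (Poly_Mapping.lookup x i $ v) * f x) z
       = of_real (Poly_Mapping.lookup z i $ v) * fiber_integral J f z"
proof -
  have "Poly_Mapping.lookup (Poly_Mapping.single 0 (embed_vec J y) + z) i $ v = Poly_Mapping.lookup z i $ v" for y
    using assms by (auto simp: lookup_add lookup_single when_def embed_vec_def)
  then show ?thesis by (simp add: fiber_integral_def)
qed

lemma schwartz_space_partial_x: "f \<in> schwartz_space \<Longrightarrow> partial_x i u f \<in> schwartz_space"
  unfolding partial_x_def by (rule schwartz_space_dir_deriv)

lemma schwartz_space_mult_coord:
  "f \<in> schwartz_space \<Longrightarrow> (\<lambda>x. complex_of_real (Poly_Mapping.lookup x i $ j) * f x) \<in> schwartz_space"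
  by (rule schwartz_space_mult_linear[OF _ bounded_linear_coord])

lemma partial_x_mult_coord:
  assumes "f \<in> schwartz_space"
  shows "partial_x i u (\<lambda>x. complex_of_real (Poly_Mapping.lookup x i $ v) * f x) x =
     complex_of_real (Poly_Mapping.lookup x i $ v) * partial_x i u f x + (if u = v then f x else 0)"
  unfolding partial_x_def dir_deriv_mult_linear[OF assms bounded_linear_coord]
  by (simp add: axis_def)

text \<open>The derivative of \<open>x\<^sup>v\<^sub>-\<^sub>1 f\<close> in the direction \<open>u\<close> has integral 0; this is the product rule for it.\<close>

lemma fiber_integral_by_parts:
  assumes f: "f \<in> schwartz_space" and u: "u \<in> J"
  shows "fiber_integral J (\<lambda>x. complex_of_real (Poly_Mapping.lookup x 0 $ v) * partial_x 0 u f x) z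
       = - (if u = v then fiber_integral J f z else 0)"
proof -
  let ?g = "\<lambda>x. complex_of_real (Poly_Mapping.lookup x 0 $ v) * partial_x 0 u f x"
  have g: "?g \<in> schwartz_space"
    by (intro schwartz_space_mult_coord schwartz_space_partial_x f)
  have f': "(\<lambda>x. (if u = v then 1 else 0) * f x) \<in> schwartz_space"
    by (rule schwartz_space_scale[OF f])
  have "0 = fiber_integral J (partial_x 0 u (\<lambda>x. complex_of_real (Poly_Mapping.lookup x 0 $ v) * f x)) z"
    by (rule fiber_integral_partial_x[symmetric, OF schwartz_space_mult_coord[OF f] u])
  also have "\<dots> = fiber_integral J (\<lambda>x. ?g x + (if u = v then 1 else 0) * f x) z"
    by (rule arg_cong[of _ _ "\<lambda>h. fiber_integral J h z"]) (auto simp: partial_x_mult_coord[OF f])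
  also have "\<dots> = fiber_integral J ?g z + (if u = v then 1 else 0) * fiber_integral J f z"
    by (simp only: fiber_integral_add[OF g f'] fiber_integral_scale)
  finally show ?thesis by (auto simp: add_eq_0_iff)
qed

section \<open>Vector fields with linear coefficients\<close>

lemma vector_field_eq_sum:
  assumes "\<And>i. N \<le> i \<Longrightarrow> Poly_Mapping.lookup x i = 0"
  shows "vector_field p q u v f x =
    (\<Sum>i<N. complex_of_real (Poly_Mapping.lookup x (i + p) $ v) * partial_x (i + q) u f x)"
  unfolding vector_field_def using assms by (intro suminf_finite) auto

lemma schwartz_space_vector_field:
  assumes f: "f \<in> schwartz_space"
  shows "vector_field p q u v f \<in> schwartz_space"
proof (rule schwartz_spaceI_local)
  fix B :: "'a rminus set" assume B: "finite B"
  obtain N where N: "\<And>x i. x \<in> span B \<Longrightarrow> N \<le> i \<Longrightarrow> Poly_Mapping.lookup x i = 0"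
    using span_bounded_support[OF B] by blast
  let ?g = "\<lambda>x. \<Sum>i<N. complex_of_real (Poly_Mapping.lookup x (i + p) $ v) * partial_x (i + q) u f x"
  have "?g \<in> schwartz_space"
    by (intro schwartz_space_sum schwartz_space_mult_coord schwartz_space_partial_x f)
  moreover have "\<forall>x\<in>span B. ?g x = vector_field p q u v f x"
    by (intro ballI vector_field_eq_sum[symmetric] N)
  ultimately show "\<exists>g\<in>schwartz_space. \<forall>x\<in>span B. g x = vector_field p q u v f x"
    by (rule bexI[of _ ?g, rotated])
qed

lemma fiber_integral_vector_field:
  assumes f: "f \<in> schwartz_space" and z: "\<And>i. N \<le> i \<Longrightarrow> Poly_Mapping.lookup z i = 0" and N: "N > 0"
  shows "fiber_integral J (vector_field p q u v f) z =
    (\<Sum>i<N. fiber_integral J (\<lambda>x. complex_of_real (Poly_Mapping.lookup x (i + p) $ v) * partial_x (i + q) u f x) z)"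
proof -
  have "Poly_Mapping.lookup (Poly_Mapping.single 0 w + z) i = 0" if "N \<le> i" for w i
    using that N z[OF that] by (simp add: lookup_add lookup_single when_def)
  then have "fiber_integral J (vector_field p q u v f) z =
    fiber_integral J (\<lambda>x. \<Sum>i<N. complex_of_real (Poly_Mapping.lookup x (i + p) $ v) * partial_x (i + q) u f x) z"
    unfolding fiber_integral_def
    by (intro Bochner_Integration.integral_cong refl vector_field_eq_sum)
  also have "\<dots> = (\<Sum>i<N. fiber_integral J (\<lambda>x. complex_of_real (Poly_Mapping.lookup x (i + p) $ v) * partial_x (i + q) u f x) z)"
    by (intro fiber_integral_sum schwartz_space_mult_coord schwartz_space_partial_x f)
  finally show ?thesis .
qed

text \<open>Write the vector field as a sum over \<open>i\<close>. The term \<open>i = 0\<close> differentiates in the direction of the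
  integration. Its coefficient is constant on the fibre if \<open>j > 0\<close>, so it contributes
  nothing; if \<open>j = 0\<close>, integration by parts gives the defect. In the other terms the coefficient is
  constant on the fibre and the derivative commutes with the integral, and prepending a coordinate
  shifts \<open>i + 1\<close> to \<open>i\<close>.\<close>

lemma pi_t_vector_field:
  fixes f :: "'n::finite rminus \<Rightarrow> complex"
  assumes f: "f \<in> schwartz_space"
  shows "pi_t (vector_field j 0 u v f) x =
    vector_field j 0 u v (pi_t f) x - (if j = 0 \<and> u = v then pi_t f x else 0)"
proof -
  obtain N where N: "\<And>i. N \<le> i \<Longrightarrow> Poly_Mapping.lookup x i = 0"
    using span_bounded_support[of "{x}"] by (metis finite.emptyI finite.insertI insertI1 span_base)
  define z where "z = prepend 0 x"
  have zS: "Poly_Mapping.lookup z (Suc i) = Poly_Mapping.lookup x i" for i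
    by (simp add: z_def prepend.rep_eq)
  have z: "Poly_Mapping.lookup z i = 0" if "Suc N \<le> i" for i
    using that N by (cases i) (auto simp: zS)
  have pi: "pi_t f y = fiber_integral UNIV f (prepend 0 y)" for y
    by (rule pi_t_eq_fiber_integral[OF f])
  have shift: "fiber_integral UNIV (partial_x (Suc i) u f) z = partial_x i u (pi_t f) x" for i u
  proof -
    let ?e = "Poly_Mapping.single i (axis u 1) :: 'n rminus"
    have "prepend 0 x + s *\<^sub>R prepend 0 ?e = prepend 0 (x + s *\<^sub>R ?e)" for s
      using prepend_add[of 0 0 x "s *\<^sub>R ?e"] prepend_scaleR[of s 0 ?e] by simp
    then have "dir_deriv (prepend 0 ?e) (fiber_integral UNIV f) (prepend 0 x) = dir_deriv ?e (pi_t f) x"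
      by (simp add: dir_deriv_def pi)
    then show ?thesis
      by (simp add: partial_x_def fiber_integral_dir_deriv[OF f] z_def prepend_zero_single)
  qed
  let ?T = "\<lambda>i. fiber_integral UNIV (\<lambda>x. complex_of_real (Poly_Mapping.lookup x (i + j) $ v) * partial_x i u f x) z"
  have "pi_t (vector_field j 0 u v f) x = (\<Sum>i<Suc N. ?T i)"
    using fiber_integral_vector_field[OF f z, where J = UNIV and p = j and q = 0 and u = u and v = v]
    by (simp add: pi_t_eq_fiber_integral[OF schwartz_space_vector_field[OF f]] z_def)
  also have "\<dots> = ?T 0 + (\<Sum>i<N. ?T (Suc i))" by (rule sum.lessThan_Suc_shift)
  also have "?T 0 = - (if j = 0 \<and> u = v then pi_t f x else 0)"
  proof (cases "j = 0")
    case True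
    then show ?thesis using fiber_integral_by_parts[OF f, of u UNIV v z] by (simp add: pi z_def)
  next
    case False
    then show ?thesis using fiber_integral_partial_x[OF f, of u UNIV z]
      by (simp add: fiber_integral_coord_const)
  qed
  also have "(\<Sum>i<N. ?T (Suc i)) = vector_field j 0 u v (pi_t f) x"
    by (simp add: fiber_integral_coord_const shift zS vector_field_eq_sum[OF N])
  finally show ?thesis by simp
qed

section \<open>The Gaussian on the sequence space\<close>

definition sqnorm :: "'n::finite rminus \<Rightarrow> real" where
  "sqnorm x = (\<Sum>i\<in>Poly_Mapping.keys x. Poly_Mapping.lookup x i \<bullet> Poly_Mapping.lookup x i)"

definition gaussian :: "'n::finite rminus \<Rightarrow> complex" where
  "gaussian x = of_real (exp (- pi * sqnorm x))"

text \<open>Makes sums over the supports of different points comparable: all of them become sums over one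
  initial segment that is long enough.\<close>

lemma sum_keys_eq:
  fixes g :: "nat \<Rightarrow> 'c::comm_monoid_add"
  assumes "\<And>i. N \<le> i \<Longrightarrow> Poly_Mapping.lookup x i = 0" "\<And>i. Poly_Mapping.lookup x i = 0 \<Longrightarrow> g i = 0"
  shows "(\<Sum>i\<in>Poly_Mapping.keys x. g i) = (\<Sum>i<N. g i)"
proof (rule sum.mono_neutral_left)
  show "Poly_Mapping.keys x \<subseteq> {..<N}"
    using assms(1) by (auto simp: in_keys_iff not_le[symmetric])
qed (use assms(2) in \<open>auto simp: in_keys_iff\<close>)

lemma sqnorm_add_scale:
  "sqnorm (x + s *\<^sub>R v) = sqnorm x
     + 2 * s * (\<Sum>i\<in>Poly_Mapping.keys v. Poly_Mapping.lookup x i \<bullet> Poly_Mapping.lookup v i) + s\<^sup>2 * sqnorm v"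
proof -
  obtain N where N: "\<And>z i. z \<in> span {x, v} \<Longrightarrow> N \<le> i \<Longrightarrow> Poly_Mapping.lookup z i = 0"
    using span_bounded_support[of "{x, v}"] by blast
  have x: "x \<in> span {x, v}" and v: "v \<in> span {x, v}" by (rule span_base, simp)+
  then have xv: "x + s *\<^sub>R v \<in> span {x, v}" by (intro span_add span_scale)
  have sq: "sqnorm z = (\<Sum>i<N. Poly_Mapping.lookup z i \<bullet> Poly_Mapping.lookup z i)" if "z \<in> span {x, v}" for z
    unfolding sqnorm_def using N[OF that] by (intro sum_keys_eq) auto
  have b: "(\<Sum>i\<in>Poly_Mapping.keys v. Poly_Mapping.lookup x i \<bullet> Poly_Mapping.lookup v i) =
      (\<Sum>i<N. Poly_Mapping.lookup x i \<bullet> Poly_Mapping.lookup v i)"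
    using N[OF v] by (intro sum_keys_eq) auto
  show ?thesis
    unfolding sq[OF x] sq[OF v] sq[OF xv] b sum_distrib_left sum.distrib[symmetric]
    by (intro sum.cong refl) (simp add: lookup_add inner_add inner_commute power2_eq_square algebra_simps)
qed

lemma gaussian_has_vector_derivative:
  "((\<lambda>s. gaussian (x + s *\<^sub>R v)) has_vector_derivative
     of_real (\<Sum>i\<in>Poly_Mapping.keys v. Poly_Mapping.lookup x i \<bullet> Poly_Mapping.lookup v i) * (- 2 * pi * gaussian x)) (at 0)"
proof -
  define b where "b = (\<Sum>i\<in>Poly_Mapping.keys v. Poly_Mapping.lookup x i \<bullet> Poly_Mapping.lookup v i)"
  have "((\<lambda>s. exp (- pi * (sqnorm x + 2 * s * b + s\<^sup>2 * sqnorm v))) has_real_derivative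
      b * (- 2 * pi * exp (- pi * sqnorm x))) (at 0)"
    by (auto intro!: derivative_eq_intros)
  then have "((\<lambda>s. complex_of_real (exp (- pi * (sqnorm x + 2 * s * b + s\<^sup>2 * sqnorm v)))) has_vector_derivative
      of_real (b * (- 2 * pi * exp (- pi * sqnorm x)))) (at 0)"
    by (intro has_vector_derivative_of_real) (simp flip: has_real_derivative_iff_has_vector_derivative)
  then show ?thesis
    by (simp add: gaussian_def sqnorm_add_scale b_def)
qed

lemma dir_deriv_gaussian:
  "dir_deriv v gaussian x =
     of_real (\<Sum>i\<in>Poly_Mapping.keys v. Poly_Mapping.lookup x i \<bullet> Poly_Mapping.lookup v i) * (- 2 * pi * gaussian x)"
  by (rule dir_deriv_eqI[OF gaussian_has_vector_derivative])

text \<open>The exponential function dominates each term of its power series.\<close>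

lemma power_mult_exp_minus_le:
  fixes t c :: real
  assumes "t \<ge> 0" "c > 0"
  shows "t ^ m * exp (- c * t) \<le> fact m / c ^ m"
proof -
  have "(c * t) ^ m / fact m \<le> exp (c * t)"
  proof -
    have "(\<Sum>k\<in>{m}. (c * t) ^ k / fact k) \<le> suminf (\<lambda>k. (c * t) ^ k / fact k)"
      using assms summable_exp[of "c * t"]
      by (intro sum_le_suminf) (auto simp: divide_inverse mult.commute)
    then show ?thesis by (simp add: exp_def divide_inverse mult.commute)
  qed
  then have "c ^ m * t ^ m \<le> fact m * exp (c * t)"
    by (simp add: pos_divide_le_eq power_mult_distrib mult.commute)
  then have "c ^ m * t ^ m * exp (- (c * t)) \<le> fact m * exp (c * t) * exp (- (c * t))"
    by (rule mult_right_mono) simp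
  also have "\<dots> = fact m" by (simp add: mult.assoc flip: exp_add)
  finally show ?thesis using assms by (simp add: pos_le_divide_eq mult_ac)
qed

text \<open>On the subspace only the first \<open>N\<close> vectors matter, so the Cauchy-Schwarz inequality bounds
  \<open>\<bar>x\<bar>\<^sup>2\<close> below by \<open>\<parallel>x\<parallel>\<^sup>2 / N\<close>, where \<open>\<parallel>x\<parallel>\<close>, the norm of the sequence space, is the sum of the Euclidean
  norms of the vectors.\<close>

lemma rapid_on_gaussian:
  fixes B :: "'n::finite rminus set"
  assumes "finite B"
  shows "rapid_on (span B) gaussian"
proof -
  obtain N' where N': "\<And>x i. x \<in> span B \<Longrightarrow> N' \<le> i \<Longrightarrow> Poly_Mapping.lookup x i = 0"
    using span_bounded_support[OF assms] by blast
  \<comment> \<open>The passage to the successor makes the bound positive, so that dividing by it is harmless.\<close>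
  define N where "N = Suc N'"
  have N: "\<And>x i. x \<in> span B \<Longrightarrow> N \<le> i \<Longrightarrow> Poly_Mapping.lookup x i = 0" and N0: "N > 0"
    using N' by (auto simp: N_def)
  have sq: "sqnorm x = (\<Sum>i<N. (norm (Poly_Mapping.lookup x i))\<^sup>2)" if "x \<in> span B" for x
    unfolding sqnorm_def power2_norm_eq_inner using N[OF that] by (intro sum_keys_eq) auto
  have "continuous_on (span B) (\<lambda>x. complex_of_real (exp (- pi * (\<Sum>i<N. (norm (Poly_Mapping.lookup x i))\<^sup>2))))"
    by (intro continuous_intros bounded_linear.continuous_on[OF bounded_linear_lookup])
  then have "continuous_on (span B) gaussian"
    using continuous_on_cong[OF refl, of "span B" gaussian] by (simp add: gaussian_def sq)
  moreover have "norm x ^ m * norm (gaussian x) \<le> 1 + fact m / (pi / N) ^ m" if x: "x \<in> span B" for x m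
  proof -
    have "(norm x)\<^sup>2 = (\<Sum>i<N. norm (Poly_Mapping.lookup x i))\<^sup>2"
      unfolding norm_rminus_eq using N[OF x] by (subst sum_keys_eq[of N]) auto
    also have "\<dots> \<le> (\<Sum>i<N. (norm (Poly_Mapping.lookup x i))\<^sup>2) * card {..<N}"
      by (rule sum_squared_le_sum_of_squares)
    finally have le: "(norm x)\<^sup>2 / N \<le> sqnorm x"
      using N0 by (simp add: sq[OF x] pos_divide_le_eq)
    have "norm (gaussian x) = exp (- pi * sqnorm x)" by (simp add: gaussian_def)
    also have "\<dots> \<le> exp (- (pi / N) * (norm x)\<^sup>2)"
      using mult_left_mono[OF le, of pi] by simp
    finally have g: "norm (gaussian x) \<le> exp (- (pi / N) * (norm x)\<^sup>2)" .
    have "norm x ^ m \<le> 1 + ((norm x)\<^sup>2) ^ m"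
    proof (cases "norm x \<le> 1")
      case True
      then have "norm x ^ m \<le> 1" by (intro power_le_one) auto
      moreover have "0 \<le> ((norm x)\<^sup>2) ^ m" by simp
      ultimately show ?thesis by linarith
    next
      case False
      then have "norm x ^ m \<le> norm x ^ (2 * m)" by (intro power_increasing) auto
      then show ?thesis by (simp add: power_mult)
    qed
    then have "norm x ^ m * norm (gaussian x) \<le> (1 + ((norm x)\<^sup>2) ^ m) * exp (- (pi / N) * (norm x)\<^sup>2)"
      using g by (intro mult_mono) auto
    also have "\<dots> = exp (- (pi / N) * (norm x)\<^sup>2) + ((norm x)\<^sup>2) ^ m * exp (- (pi / N) * (norm x)\<^sup>2)"
      by (simp add: distrib_right)
    also have "\<dots> \<le> 1 + fact m / (pi / N) ^ m"
      using N0 by (intro add_mono power_mult_exp_minus_le) auto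
    finally show ?thesis .
  qed
  ultimately show ?thesis
    unfolding rapid_on_def using gaussian_has_vector_derivative differentiableI_vector by blast
qed

text \<open>The derivative in the direction \<open>v\<close> is \<open>- 2 \<pi> \<langle>x, v\<rangle> G(x)\<close>, a linear function times the Gaussian.\<close>

lemma schwartz_space_gaussian: "gaussian \<in> schwartz_space"
  unfolding schwartz_space_def
proof (intro CollectI allI impI)
  fix B :: "'a rminus set" assume B: "finite B"
  have "dir_deriv v gaussian \<in> poly_module (span B) {gaussian}" for v
  proof -
    have "bounded_linear (\<lambda>x. \<Sum>i\<in>Poly_Mapping.keys v. Poly_Mapping.lookup x i \<bullet> Poly_Mapping.lookup v i)"
      by (intro bounded_linear_sum bounded_linear_compose[OF bounded_linear_inner_left bounded_linear_lookup])
    moreover have "(\<lambda>x. - 2 * pi * gaussian x) \<in> poly_module (span B) {gaussian}"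
      by (rule poly_module.scale, rule poly_module.base) simp
    ultimately show ?thesis
      unfolding dir_deriv_gaussian[abs_def] by (rule poly_module.mult_linear[rotated])
  qed
  then show "schwartz_on (span B) gaussian"
    by (intro schwartz_on_poly_module[where F = "{gaussian}"])
      (auto simp: rapid_on_gaussian[OF B] intro: poly_module.base)
qed

section \<open>An eigenfunction of \<open>\<pi>\<^sub>t\<close>\<close>

lemma has_bochner_integral_gaussian: "has_bochner_integral lborel (\<lambda>s::real. exp (- pi * s\<^sup>2)) 1"
proof -
  \<comment> \<open>For this standard deviation the normal density is \<open>exp(-\<pi>s\<^sup>2)\<close> without a prefactor.\<close>
  define \<sigma> where "\<sigma> = 1 / sqrt (2 * pi)"
  have \<sigma>: "\<sigma> > 0" "\<sigma>\<^sup>2 = 1 / (2 * pi)" by (simp_all add: \<sigma>_def power_divide)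
  have "normal_density 0 \<sigma> s = exp (- pi * s\<^sup>2)" for s
    by (simp add: normal_density_def \<sigma>(2))
  then show ?thesis
    using normal_moment_even[OF \<sigma>(1), of 0 0] by simp
qed

lemma gaussian_add_first:
  assumes "Poly_Mapping.lookup z 0 = 0"
  shows "gaussian (Poly_Mapping.single 0 (embed_vec J y) + z)
       = (\<Prod>j\<in>J. complex_of_real (exp (- pi * (y j)\<^sup>2))) * gaussian z"
proof -
  let ?w = "embed_vec J y"
  have "sqnorm (z + 1 *\<^sub>R Poly_Mapping.single 0 ?w) = sqnorm z + sqnorm (Poly_Mapping.single 0 ?w)"
    unfolding sqnorm_add_scale using assms by (simp add: lookup_single when_def)
  moreover have "sqnorm (Poly_Mapping.single 0 ?w) = ?w \<bullet> ?w"
    by (simp add: sqnorm_def)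
  moreover have "?w \<bullet> ?w = (\<Sum>j\<in>J. (y j)\<^sup>2)"
  proof -
    have "?w \<bullet> ?w = (\<Sum>j\<in>UNIV. if j \<in> J then (y j)\<^sup>2 else 0)"
      unfolding inner_vec_def by (intro sum.cong) (auto simp: embed_vec_def power2_eq_square)
    then show ?thesis by (simp add: sum.If_cases)
  qed
  ultimately have "sqnorm (Poly_Mapping.single 0 ?w + z) = (\<Sum>j\<in>J. (y j)\<^sup>2) + sqnorm z"
    by (simp add: add.commute)
  moreover have "exp (- pi * ((\<Sum>j\<in>J. (y j)\<^sup>2) + sqnorm z)) = (\<Prod>j\<in>J. exp (- pi * (y j)\<^sup>2)) * exp (- pi * sqnorm z)"
    by (simp add: distrib_left exp_add[symmetric] sum_distrib_left sum_negf flip: exp_sum)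
  ultimately show ?thesis by (simp add: gaussian_def)
qed

lemma fiber_integral_gaussian:
  assumes "Poly_Mapping.lookup z 0 = 0"
  shows "fiber_integral J gaussian z = gaussian z"
proof -
  have "has_bochner_integral lborel (\<lambda>s. complex_of_real (exp (- pi * s\<^sup>2))) (of_real 1)"
    by (rule has_bochner_integral_of_real[OF has_bochner_integral_gaussian])
  then have "(LINT y|Pi\<^sub>M J (\<lambda>_. lborel). (\<Prod>j\<in>J. complex_of_real (exp (- pi * (y j)\<^sup>2)))) = 1"
    by (subst lborel_PiM.product_integral_prod) (auto simp: has_bochner_integral_iff)
  then show ?thesis
    by (simp add: fiber_integral_def gaussian_add_first[OF assms])
qed

text \<open>Integration by parts for the Gaussian, since \<open>\<partial>\<^sub>k G = - 2 \<pi> x\<^sup>k\<^sub>-\<^sub>1 G\<close>.\<close>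

lemma fiber_integral_second_moment:
  assumes k: "k \<in> J" and z: "Poly_Mapping.lookup z 0 = 0"
  shows "2 * pi * fiber_integral J (\<lambda>x. complex_of_real (Poly_Mapping.lookup x 0 $ k)
            * (complex_of_real (Poly_Mapping.lookup x 0 $ k) * gaussian x)) z = gaussian z"
    (is "_ * fiber_integral J ?h z = _")
proof -
  have d: "partial_x 0 k gaussian x = - 2 * pi * (complex_of_real (Poly_Mapping.lookup x 0 $ k) * gaussian x)" for x
    by (simp add: partial_x_def dir_deriv_gaussian inner_axis axis_eq_0_iff)
  have "- gaussian z = fiber_integral J (\<lambda>x. complex_of_real (Poly_Mapping.lookup x 0 $ k) * partial_x 0 k gaussian x) z"
    using fiber_integral_by_parts[OF schwartz_space_gaussian k, of k z] by (simp add: fiber_integral_gaussian z)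
  also have "\<dots> = fiber_integral J (\<lambda>x. (- 2 * pi) * ?h x) z"
    by (simp add: d mult_ac)
  also have "\<dots> = (- 2 * pi) * fiber_integral J ?h z" by (rule fiber_integral_scale)
  finally show ?thesis by (simp add: minus_equation_iff)
qed

text \<open>\<open>G(x) (1 + 2\<pi>(\<lambda>-1) \<Sum>i\<ge>0. \<lambda>\<^sup>i (x\<^sup>k\<^bsub>-i-1\<^esub>)\<^sup>2)\<close>. The factor \<open>G\<close> is distributed over the sum, and each
  square is written as an iterated product with a coordinate, so that the summands are visibly
  Schwartz functions.\<close>

definition eigenfunction :: "complex \<Rightarrow> 'n \<Rightarrow> 'n::finite rminus \<Rightarrow> complex" where
  "eigenfunction lam k x = gaussian x + complex_of_real (2 * pi) * (lam - 1) *
     (\<Sum>i\<in>Poly_Mapping.keys x. lam ^ i * (complex_of_real (Poly_Mapping.lookup x i $ k)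
        * (complex_of_real (Poly_Mapping.lookup x i $ k) * gaussian x)))"

lemma eigenfunction_eq:
  assumes "\<And>i. N \<le> i \<Longrightarrow> Poly_Mapping.lookup x i = 0"
  shows "eigenfunction lam k x = gaussian x + complex_of_real (2 * pi) * (lam - 1) *
     (\<Sum>i<N. lam ^ i * (complex_of_real (Poly_Mapping.lookup x i $ k)
        * (complex_of_real (Poly_Mapping.lookup x i $ k) * gaussian x)))"
  unfolding eigenfunction_def using assms by (subst sum_keys_eq[of N]) auto

lemma schwartz_space_eigenfunction_sum:
  "(\<lambda>x. gaussian x + complex_of_real (2 * pi) * (lam - 1) *
     (\<Sum>i<N. lam ^ i * (complex_of_real (Poly_Mapping.lookup x i $ k)
        * (complex_of_real (Poly_Mapping.lookup x i $ k) * gaussian x)))) \<in> schwartz_space"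
  by (intro schwartz_space_add schwartz_space_gaussian)
    (rule schwartz_space_scale, rule schwartz_space_sum, rule schwartz_space_scale,
     intro schwartz_space_mult_coord schwartz_space_gaussian)

lemma schwartz_space_eigenfunction: "eigenfunction lam k \<in> schwartz_space"
proof (rule schwartz_spaceI_local)
  fix B :: "'a rminus set" assume B: "finite B"
  obtain N where N: "\<And>x i. x \<in> span B \<Longrightarrow> N \<le> i \<Longrightarrow> Poly_Mapping.lookup x i = 0"
    using span_bounded_support[OF B] by blast
  show "\<exists>g\<in>schwartz_space. \<forall>x\<in>span B. g x = eigenfunction lam k x"
    by (rule bexI[OF _ schwartz_space_eigenfunction_sum[where lam = lam and N = N and k = k]])
      (intro ballI eigenfunction_eq[symmetric] N)
qed

text \<open>In the sum at \<open>(y, x)\<close> the term \<open>i = 0\<close> contains \<open>(y\<^sup>k)\<^sup>2\<close>, whose mean is \<open>1/(2\<pi>)\<close> because \<open>k \<in> J\<close>,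
  and the terms \<open>i + 1\<close> are \<open>\<lambda>\<close> times the terms \<open>i\<close> at \<open>x\<close>. With \<open>J\<close> the set of all indices this is
  the eigenvalue equation; with \<open>J = {1, \<dots>, k}\<close> it evaluates \<open>I\<^sub>k\<close>.\<close>

lemma fiber_integral_eigenfunction:
  assumes k: "k \<in> J"
  shows "fiber_integral J (eigenfunction lam k) (prepend 0 x) = lam * eigenfunction lam k x"
proof -
  obtain N where N: "\<And>i. N \<le> i \<Longrightarrow> Poly_Mapping.lookup x i = 0"
    using span_bounded_support[of "{x}"] by (metis finite.emptyI finite.insertI insertI1 span_base)
  define z where "z = prepend 0 x"
  have zS: "Poly_Mapping.lookup z (Suc i) = Poly_Mapping.lookup x i" and z0: "Poly_Mapping.lookup z 0 = 0" for i
    by (simp_all add: z_def prepend.rep_eq)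
  have z: "Poly_Mapping.lookup (Poly_Mapping.single 0 w + z) i = 0" if "Suc N \<le> i" for i w
    using that N by (cases i) (auto simp: zS lookup_add lookup_single when_def)
  have gz: "gaussian z = gaussian x"
  proof -
    have "sqnorm z = (\<Sum>i<Suc N. Poly_Mapping.lookup z i \<bullet> Poly_Mapping.lookup z i)"
      unfolding sqnorm_def using z[of _ 0] by (intro sum_keys_eq) auto
    also have "\<dots> = (\<Sum>i<N. Poly_Mapping.lookup x i \<bullet> Poly_Mapping.lookup x i)"
      unfolding sum.lessThan_Suc_shift by (simp add: z0 zS)
    also have "\<dots> = sqnorm x"
      unfolding sqnorm_def using N by (intro sum_keys_eq[symmetric]) auto
    finally show ?thesis by (simp add: gaussian_def)
  qed
  let ?h = "\<lambda>i x. complex_of_real (Poly_Mapping.lookup x i $ k)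
        * (complex_of_real (Poly_Mapping.lookup x i $ k) * gaussian x)"
  have h: "?h i \<in> schwartz_space" for i
    by (intro schwartz_space_mult_coord schwartz_space_gaussian)
  have hl: "(\<lambda>x. lam ^ i * ?h i x) \<in> schwartz_space" for i by (rule schwartz_space_scale[OF h])
  have hs: "(\<lambda>x. \<Sum>i<Suc N. lam ^ i * ?h i x) \<in> schwartz_space" by (rule schwartz_space_sum) (rule hl)
  have "fiber_integral J (eigenfunction lam k) z
      = fiber_integral J (\<lambda>x. gaussian x + complex_of_real (2 * pi) * (lam - 1) * (\<Sum>i<Suc N. lam ^ i * ?h i x)) z"
    unfolding fiber_integral_def by (intro Bochner_Integration.integral_cong refl eigenfunction_eq z)
  also have "\<dots> = fiber_integral J gaussian z + fiber_integral J (\<lambda>x. complex_of_real (2 * pi) * (lam - 1) * (\<Sum>i<Suc N. lam ^ i * ?h i x)) z"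
    by (rule fiber_integral_add[OF schwartz_space_gaussian schwartz_space_scale[OF hs]])
  also have "\<dots> = gaussian z + complex_of_real (2 * pi) * (lam - 1) * (\<Sum>i<Suc N. lam ^ i * fiber_integral J (?h i) z)"
    by (simp only: fiber_integral_scale fiber_integral_sum[OF hl] fiber_integral_gaussian[OF z0])
  also have "(\<Sum>i<Suc N. lam ^ i * fiber_integral J (?h i) z)
      = fiber_integral J (?h 0) z + (\<Sum>i<N. lam ^ Suc i * ?h i x)"
    unfolding sum.lessThan_Suc_shift
    by (simp add: fiber_integral_coord_const zS fiber_integral_gaussian[OF z0] gz)
  finally have "fiber_integral J (eigenfunction lam k) z
      = gaussian z + (lam - 1) * (complex_of_real (2 * pi) * fiber_integral J (?h 0) z)
        + complex_of_real (2 * pi) * (lam - 1) * (\<Sum>i<N. lam ^ Suc i * ?h i x)"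
    by (simp add: algebra_simps)
  also have "\<dots> = lam * (gaussian z + complex_of_real (2 * pi) * (lam - 1) * (\<Sum>i<N. lam ^ i * ?h i x))"
    unfolding fiber_integral_second_moment[OF k z0]
    by (simp add: sum_distrib_left algebra_simps)
  also have "\<dots> = lam * eigenfunction lam k x"
    by (simp add: eigenfunction_eq[OF N] gz)
  finally show ?thesis by (simp add: z_def)
qed

lemma schwartz_eigen_eigenfunction: "eigenfunction lam k \<in> schwartz_eigen lam"
  by (auto simp: schwartz_eigen_def schwartz_space_eigenfunction fun_eq_iff
      pi_t_eq_fiber_integral fiber_integral_eigenfunction)

section \<open>The eigenspace as a module over the nonnegative modes\<close>

lemma pi_t_add:
  "f \<in> schwartz_space \<Longrightarrow> g \<in> schwartz_space \<Longrightarrow> pi_t (\<lambda>x. f x + g x) x = pi_t f x + pi_t g x"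
  by (simp add: pi_t_eq_fiber_integral schwartz_space_add fiber_integral_add)

lemma pi_t_scale: "pi_t (\<lambda>x. c * f x) x = c * pi_t f x"
  by (simp add: pi_t_def)

lemma pi_t_sum:
  "(\<And>i. i \<in> I \<Longrightarrow> f i \<in> schwartz_space) \<Longrightarrow> pi_t (\<lambda>x. \<Sum>i\<in>I. f i x) x = (\<Sum>i\<in>I. pi_t (f i) x)"
  by (simp add: pi_t_eq_fiber_integral schwartz_space_sum fiber_integral_sum)

lemma schwartz_eigen_imp_space: "f \<in> schwartz_eigen lam \<Longrightarrow> f \<in> schwartz_space"
  by (simp add: schwartz_eigen_def)

lemma schwartz_eigen_pi_t: "f \<in> schwartz_eigen lam \<Longrightarrow> pi_t f x = lam * f x"
  by (simp add: schwartz_eigen_def)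

lemma schwartz_eigenI:
  "f \<in> schwartz_space \<Longrightarrow> (\<And>x. pi_t f x = lam * f x) \<Longrightarrow> f \<in> schwartz_eigen lam"
  by (simp add: schwartz_eigen_def fun_eq_iff)

lemma schwartz_eigen_add:
  assumes "f \<in> schwartz_eigen lam" "g \<in> schwartz_eigen lam"
  shows "(\<lambda>x. f x + g x) \<in> schwartz_eigen lam"
  using assms by (intro schwartz_eigenI schwartz_space_add)
    (simp_all add: pi_t_add schwartz_eigen_imp_space schwartz_eigen_pi_t distrib_left)

lemma schwartz_eigen_scale:
  assumes "f \<in> schwartz_eigen lam"
  shows "(\<lambda>x. c * f x) \<in> schwartz_eigen lam"
  using assms by (intro schwartz_eigenI schwartz_space_scale)
    (simp_all add: pi_t_scale schwartz_eigen_imp_space schwartz_eigen_pi_t)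

lemma schwartz_eigen_sum:
  assumes "\<And>i. i \<in> I \<Longrightarrow> f i \<in> schwartz_eigen lam"
  shows "(\<lambda>x. \<Sum>i\<in>I. f i x) \<in> schwartz_eigen lam"
proof (rule schwartz_eigenI)
  have S: "f i \<in> schwartz_space" if "i \<in> I" for i
    using assms[OF that] by (rule schwartz_eigen_imp_space)
  then show "(\<lambda>x. \<Sum>i\<in>I. f i x) \<in> schwartz_space" by (rule schwartz_space_sum)
  show "pi_t (\<lambda>x. \<Sum>i\<in>I. f i x) x = lam * (\<Sum>i\<in>I. f i x)" for x
    by (simp add: pi_t_sum[OF S] schwartz_eigen_pi_t[OF assms] sum_distrib_left)
qed

lemma vector_field_scale:
  assumes "f \<in> schwartz_space"
  shows "vector_field p q u v (\<lambda>x. c * f x) x = c * vector_field p q u v f x"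
proof -
  obtain N where N: "\<And>i. N \<le> i \<Longrightarrow> Poly_Mapping.lookup x i = 0"
    using span_bounded_support[of "{x}"] by (metis finite.emptyI finite.insertI insertI1 span_base)
  show ?thesis
    by (simp add: vector_field_eq_sum[OF N] partial_x_def dir_deriv_scale[OF assms] sum_distrib_left mult_ac)
qed

lemma pi_mode_nonneg:
  "m \<ge> 0 \<Longrightarrow> pi_mode lam a m f x = (\<Sum>u\<in>UNIV. \<Sum>v\<in>UNIV. (- a $ u $ v) * vector_field (nat m) 0 u v f x)"
  by (simp add: pi_mode_def sum_negf)

text \<open>The defects of \<open>pi_t_vector_field\<close> add up to a multiple of the trace of \<open>a\<close>.\<close>

lemma schwartz_eigen_pi_mode:
  assumes f: "f \<in> schwartz_eigen lam" and m: "m \<ge> 0" and a: "trace a = 0"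
  shows "pi_mode lam a m f \<in> schwartz_eigen lam"
proof (rule schwartz_eigenI)
  have fS: "f \<in> schwartz_space" using f by (rule schwartz_eigen_imp_space)
  have eq: "pi_mode lam a m f = (\<lambda>x. \<Sum>u\<in>UNIV. \<Sum>v\<in>UNIV. (- a $ u $ v) * vector_field (nat m) 0 u v f x)"
    using pi_mode_nonneg[OF m] by blast
  have S: "(\<lambda>x. (- a $ u $ v) * vector_field (nat m) 0 u v f x) \<in> schwartz_space" for u v
    by (rule schwartz_space_scale[OF schwartz_space_vector_field[OF fS]])
  have S': "(\<lambda>x. \<Sum>v\<in>UNIV. (- a $ u $ v) * vector_field (nat m) 0 u v f x) \<in> schwartz_space" for u
    by (rule schwartz_space_sum) (rule S)
  show "pi_mode lam a m f \<in> schwartz_space"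
    unfolding eq by (rule schwartz_space_sum) (rule S')
  fix x
  have vf: "pi_t (vector_field (nat m) 0 u v f) x
      = lam * vector_field (nat m) 0 u v f x - (if nat m = 0 \<and> u = v then lam * f x else 0)" for u v
  proof -
    have "pi_t f = (\<lambda>x. lam * f x)" using schwartz_eigen_pi_t[OF f] by blast
    then show ?thesis by (simp add: pi_t_vector_field[OF fS] vector_field_scale[OF fS])
  qed
  have "pi_t (pi_mode lam a m f) x = (\<Sum>u\<in>UNIV. \<Sum>v\<in>UNIV. (- a $ u $ v) * pi_t (vector_field (nat m) 0 u v f) x)"
    unfolding eq by (simp only: pi_t_sum[OF S'] pi_t_sum[OF S] pi_t_scale)
  also have "\<dots> = (\<Sum>u\<in>UNIV. \<Sum>v\<in>UNIV. lam * ((- a $ u $ v) * vector_field (nat m) 0 u v f x)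
        + (if u = v then (if nat m = 0 then a $ u $ v * (lam * f x) else 0) else 0))"
    unfolding vf by (intro sum.cong refl) (auto simp: algebra_simps)
  also have "\<dots> = lam * pi_mode lam a m f x + (\<Sum>u\<in>UNIV. if nat m = 0 then a $ u $ u * (lam * f x) else 0)"
    unfolding sum.distrib pi_mode_nonneg[OF m] by (simp add: sum_distrib_left)
  also have "(\<Sum>u\<in>UNIV. if nat m = 0 then a $ u $ u * (lam * f x) else 0) = 0"
    using a by (cases "nat m = 0") (simp_all add: trace_def sum_distrib_right[symmetric])
  finally show "pi_t (pi_mode lam a m f) x = lam * pi_mode lam a m f x" by simp
qed

lemma schwartz_eigen_pi_rep:
  assumes "f \<in> schwartz_eigen lam" "X \<in> affine_sl" "\<And>m. m < 0 \<Longrightarrow> Poly_Mapping.lookup (fst X) m = 0"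
  shows "pi_rep lam X f \<in> schwartz_eigen lam"
proof -
  have "m \<ge> 0" if "m \<in> Poly_Mapping.keys (fst X)" for m
    using that assms(3) by (metis in_keys_iff not_le)
  then have *: "(\<lambda>x. \<Sum>m\<in>Poly_Mapping.keys (fst X). pi_mode lam (Poly_Mapping.lookup (fst X) m) m f x)
      \<in> schwartz_eigen lam"
    using assms by (intro schwartz_eigen_sum schwartz_eigen_pi_mode) (auto simp: affine_sl_def)
  show ?thesis
    unfolding pi_rep_def[abs_def] by (rule schwartz_eigen_add[OF * schwartz_eigen_scale[OF assms(1)]])
qed

section \<open>The functionals and their weights\<close>

lemma I_functional_eq:
  "f \<in> schwartz_eigen lam \<Longrightarrow> I_functional lam k f = fiber_integral {..k} f 0"
  by (simp add: I_functional_def fiber_integral_def embed_vec_def)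

text \<open>On the fibre through 0 all coordinates vanish except the \<open>x\<^sup>v\<^sub>-\<^sub>1\<close> with \<open>v \<le> k\<close>, so a single term
  of the vector field can survive, namely \<open>x\<^sup>v\<^sub>-\<^sub>1 \<partial>\<^sub>u\<close> for \<open>j = 0\<close>. The condition \<open>u \<le> v\<close> ensures that the
  derivative is in a direction of integration whenever the coefficient is not zero.\<close>

lemma fiber_integral_vector_field_origin:
  fixes f :: "'n::{finite,linorder} rminus \<Rightarrow> complex"
  assumes f: "f \<in> schwartz_space" and uv: "j = 0 \<Longrightarrow> u \<le> v"
  shows "fiber_integral {..k} (vector_field j 0 u v f) 0
       = - (if j = 0 \<and> u = v \<and> u \<le> k then fiber_integral {..k} f 0 else 0)"
proof -
  have "fiber_integral {..k} (vector_field j 0 u v f) 0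
      = fiber_integral {..k} (\<lambda>x. complex_of_real (Poly_Mapping.lookup x j $ v) * partial_x 0 u f x) 0"
    using fiber_integral_vector_field[OF f, of 1 0 "{..k}" j 0 u v] by simp
  also have "\<dots> = - (if j = 0 \<and> u = v \<and> u \<le> k then fiber_integral {..k} f 0 else 0)"
  proof (cases "j = 0 \<and> v \<le> k")
    case True
    moreover have "u \<le> k" using order_trans[OF uv] True by simp
    ultimately show ?thesis using fiber_integral_by_parts[OF f, of u "{..k}" v 0] by auto
  next
    case False
    then show ?thesis by (subst fiber_integral_coord_const) auto
  qed
  finally show ?thesis .
qed

lemma fiber_integral_pi_mode:
  fixes f :: "'n::{finite,linorder} rminus \<Rightarrow> complex"
  assumes f: "f \<in> schwartz_space" and m: "m \<ge> 0"
    and a: "\<And>u v. m = 0 \<Longrightarrow> v < u \<Longrightarrow> a $ u $ v = 0"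
  shows "fiber_integral {..k} (pi_mode lam a m f) 0
       = (if m = 0 then (\<Sum>u\<in>{..k}. a $ u $ u) * fiber_integral {..k} f 0 else 0)"
proof -
  have S: "(\<lambda>x. (- a $ u $ v) * vector_field (nat m) 0 u v f x) \<in> schwartz_space" for u v
    by (rule schwartz_space_scale[OF schwartz_space_vector_field[OF f]])
  have S': "(\<lambda>x. \<Sum>v\<in>UNIV. (- a $ u $ v) * vector_field (nat m) 0 u v f x) \<in> schwartz_space" for u
    by (rule schwartz_space_sum) (rule S)
  have "fiber_integral {..k} (pi_mode lam a m f) 0
      = fiber_integral {..k} (\<lambda>x. \<Sum>u\<in>UNIV. \<Sum>v\<in>UNIV. (- a $ u $ v) * vector_field (nat m) 0 u v f x) 0"
    by (simp add: fiber_integral_def pi_mode_nonneg[OF m])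
  also have "\<dots> = (\<Sum>u\<in>UNIV. \<Sum>v\<in>UNIV. (- a $ u $ v) * fiber_integral {..k} (vector_field (nat m) 0 u v f) 0)"
    by (simp only: fiber_integral_sum[OF S'] fiber_integral_sum[OF S] fiber_integral_scale)
  also have "\<dots> = (\<Sum>u\<in>UNIV. \<Sum>v\<in>UNIV. if u = v then
      (if m = 0 \<and> u \<le> k then a $ u $ u * fiber_integral {..k} f 0 else 0) else 0)"
  proof (intro sum.cong refl)
    fix u v
    show "(- a $ u $ v) * fiber_integral {..k} (vector_field (nat m) 0 u v f) 0 = (if u = v then
        (if m = 0 \<and> u \<le> k then a $ u $ u * fiber_integral {..k} f 0 else 0) else 0)"
    \<comment> \<open>Below the diagonal the coefficient vanishes.\<close>
    proof (cases "m = 0 \<longrightarrow> u \<le> v")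
      case True
      then have "nat m = 0 \<Longrightarrow> u \<le> v" using m by simp
      from fiber_integral_vector_field_origin[OF f this] show ?thesis using m by simp
    next
      case False
      then have "v < u" by auto
      with False show ?thesis using a[of v u] by auto
    qed
  qed
  also have "\<dots> = (\<Sum>u\<in>UNIV. if m = 0 \<and> u \<le> k then a $ u $ u * fiber_integral {..k} f 0 else 0)"
    by simp
  also have "\<dots> = (if m = 0 then (\<Sum>u\<in>{..k}. a $ u $ u) * fiber_integral {..k} f 0 else 0)"
    by (simp add: sum_distrib_right sum.inter_filter[symmetric] atMost_def)
  finally show ?thesis .
qed

definition I_weight :: "'n::{finite,linorder} \<Rightarrow> 'n affine \<Rightarrow> complex" where
  "I_weight k X = - (\<Sum>u\<in>{..k}. Poly_Mapping.lookup (fst X) 0 $ u $ u) - snd X"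

text \<open>Besides the central term only the diagonal entries up to \<open>k\<close> of the degree 0 part contribute, by
  integration by parts. Every other entry has a vector field that vanishes on the fibre or integrates to zero.\<close>

lemma pi_star_I_functional:
  assumes X: "X \<in> affine_sl" and neg: "\<And>m. m < 0 \<Longrightarrow> Poly_Mapping.lookup (fst X) m = 0"
    and upper: "\<And>u v. v < u \<Longrightarrow> Poly_Mapping.lookup (fst X) 0 $ u $ v = 0"
  shows "pi_star lam X (I_functional lam k) = (\<lambda>f\<in>schwartz_eigen lam. I_weight k X * I_functional lam k f)"
  unfolding pi_star_def
proof (rule restrict_ext)
  fix f :: "'a rminus \<Rightarrow> complex" assume f: "f \<in> schwartz_eigen lam"
  have fS: "f \<in> schwartz_space" using f by (rule schwartz_eigen_imp_space)
  let ?K = "Poly_Mapping.keys (fst X)" and ?a = "Poly_Mapping.lookup (fst X)"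
  let ?I = "fiber_integral {..k} f 0"
  have K: "m \<ge> 0" if "m \<in> ?K" for m
    using that neg by (metis in_keys_iff not_le)
  have S: "pi_mode lam (?a m) m f \<in> schwartz_space" if "m \<in> ?K" for m
    using X K[OF that] by (intro schwartz_eigen_imp_space[OF schwartz_eigen_pi_mode[OF f]]) (auto simp: affine_sl_def)
  have "fiber_integral {..k} (pi_rep lam X f) 0
      = (\<Sum>m\<in>?K. fiber_integral {..k} (pi_mode lam (?a m) m f) 0) + snd X * ?I"
    unfolding pi_rep_def[abs_def]
    by (simp only: fiber_integral_add[OF schwartz_space_sum[OF S] schwartz_space_scale[OF fS]]
        fiber_integral_sum[OF S] fiber_integral_scale)
  also have "(\<Sum>m\<in>?K. fiber_integral {..k} (pi_mode lam (?a m) m f) 0)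
      = (\<Sum>m\<in>?K. if m = 0 then (\<Sum>u\<in>{..k}. ?a 0 $ u $ u) * ?I else 0)"
    using fS K upper by (intro sum.cong refl) (auto simp: fiber_integral_pi_mode)
  also have "\<dots> = (\<Sum>u\<in>{..k}. ?a 0 $ u $ u) * ?I"
    by (auto simp: in_keys_iff)
  finally show "- I_functional lam k (pi_rep lam X f) = I_weight k X * I_functional lam k f"
    using f schwartz_eigen_pi_rep[OF f X neg]
    by (simp add: I_functional_eq I_weight_def algebra_simps)
qed

lemma I_functional_in_dual: "I_functional lam k \<in> schwartz_dual lam"
proof -
  have "I_functional lam k \<in> extensional (schwartz_eigen lam)"
    by (simp add: I_functional_def)
  then show ?thesis
    by (simp add: schwartz_dual_def I_functional_eq schwartz_eigen_add schwartz_eigen_scale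
        fiber_integral_add schwartz_eigen_imp_space fiber_integral_scale)
qed

lemma I_functional_eigenfunction: "I_functional lam k (eigenfunction lam k) = lam"
proof -
  have z: "prepend 0 0 = (0 :: 'a rminus)" by (simp add: prepend_zero)
  have "I_functional lam k (eigenfunction lam k) = fiber_integral {..k} (eigenfunction lam k) (prepend 0 0)"
    by (simp add: I_functional_eq schwartz_eigen_eigenfunction z)
  also have "\<dots> = lam * eigenfunction lam k 0"
    by (rule fiber_integral_eigenfunction) simp
  also have "\<dots> = lam" by (simp add: eigenfunction_def gaussian_def sqnorm_def)
  finally show ?thesis .
qed

lemma I_weight_in_cartan_dual: "I_weight k \<in> cartan_dual"
  unfolding cartan_dual_def
  by (auto simp: I_weight_def lookup_add sum.distrib affine_scale_def Poly_Mapping.map.rep_eq map_matrix_def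
      when_def sum_distrib_left algebra_simps intro!: sum.cong)

lemma I_weight_central: "I_weight k central = - 1"
  by (simp add: I_weight_def central_def)

lemma I_weight_coroot:
  assumes "next_index i i'"
  shows "I_weight k (loop (mat_unit i i - mat_unit i' i') 0) = (if i = k then - 1 else 0)"
proof -
  have "(\<Sum>u\<in>{..k}. mat_unit j j $ u $ u :: complex) = (if j \<le> k then 1 else 0)" for j :: 'a
    by (simp add: mat_unit_def)
  then have "I_weight k (loop (mat_unit i i - mat_unit i' i') 0)
      = - (if i \<le> k then 1 else 0) + (if i' \<le> k then 1 else 0)"
    by (simp add: I_weight_def loop_def sum_subtractf)
  \<comment> \<open>No index lies strictly between \<open>i\<close> and \<open>i'\<close>, so \<open>i < k\<close> forces \<open>i' \<le> k\<close>.\<close>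
  moreover have "i' \<le> k \<longleftrightarrow> i < k"
    using assms unfolding next_index_def by (meson le_less_linear less_le_trans less_imp_le)
  ultimately show ?thesis by auto
qed

theorem theorem5p1:
  fixes lam :: complex and k :: "'n::{finite,linorder}"
  assumes "CARD('n) \<ge> 2" and "lam \<noteq> 0"
  shows "\<exists>\<Lambda>\<in>cartan_dual.
     (\<forall>i i'. next_index i i' \<and> i \<noteq> k \<longrightarrow> \<Lambda> (loop (mat_unit i i - mat_unit i' i') 0) = 0) \<and>
     (\<forall>k'. next_index k k' \<longrightarrow> \<Lambda> (loop (mat_unit k k - mat_unit k' k') 0) = -1) \<and>
     \<Lambda> central = -1 \<and>
     highest_weight_vector lam \<Lambda> (I_functional lam k)"
proof (intro bexI[of _ "I_weight k"] conjI allI impI)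
  show "highest_weight_vector lam (I_weight k) (I_functional lam k)"
    unfolding highest_weight_vector_def
  proof (intro conjI ballI)
    show "I_functional lam k \<in> schwartz_dual lam" by (rule I_functional_in_dual)
    show "I_functional lam k \<noteq> (\<lambda>f\<in>schwartz_eigen lam. 0)"
    proof
      assume "I_functional lam k = (\<lambda>f\<in>schwartz_eigen lam. 0)"
      then have "I_functional lam k (eigenfunction lam k) = 0"
        by (simp add: schwartz_eigen_eigenfunction)
      with \<open>lam \<noteq> 0\<close> show False by (simp add: I_functional_eigenfunction)
    qed
    fix X :: "'n affine"
    show "pi_star lam X (I_functional lam k) = (\<lambda>f\<in>schwartz_eigen lam. 0)" if "X \<in> nplus_hat"
    proof -
      have "pi_star lam X (I_functional lam k) = (\<lambda>f\<in>schwartz_eigen lam. I_weight k X * I_functional lam k f)"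
        using that by (intro pi_star_I_functional) (auto simp: nplus_hat_def)
      moreover have "I_weight k X = 0" using that by (simp add: I_weight_def nplus_hat_def)
      ultimately show ?thesis by simp
    qed
    show "pi_star lam X (I_functional lam k) = (\<lambda>f\<in>schwartz_eigen lam. I_weight k X * I_functional lam k f)"
      if "X \<in> cartan_hat"
      using that by (intro pi_star_I_functional) (auto simp: cartan_hat_def)
  qed
qed (simp_all add: I_weight_in_cartan_dual I_weight_coroot I_weight_central)

end
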